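(* Let $I=[-1,1]$ and let $F(u,\phi)=\frac12\,\phi\circ\phi+u$. There exist $r,r'\in(0,1)$ such that, writing $\mathcal{U}=B_{\mathcal{C}^{1,1}}(0,r')$: (i) For every $u\in\mathcal{U}$, $F(u,\cdot)$ is a contraction of $B_{\mathcal{C}^{1,1}}(0,r)$ in the $C^1$ topology; therefore it admits a fixed point $\varphi_u\in B_{\mathcal{C}^{1,1}}(0,r)$, and furthermore the map $u\in\mathcal{U}\mapsto\varphi_u\in C^1(I)$ is continuous. (ii) $F$ acting on the scale $(C^1(I),C^0(I))$ satisfies the following development: for every $u_0\in\mathcal{U}$ there exist a bounded linear operator $P:\mathcal{C}^{1,1}(I)\to C^0(I)$ and a linear operator $Q:C^1(I)\to C^0(I)$, bounded when $C^1(I)$ is equipped with the $C^0$ norm, such that $$F(u_0+h,\varphi_{u_0}+z)-F(u_0,\varphi_{u_0})=P h+Q z+\big(\|h\|_{1,1}+\|z\|_{C^0}\big)\,\epsilon(h,z)$$ for all $h\in\mathcal{C}^{1,1}(I)$ with $u_0+h\in\mathcal{U}$ and all $z$ with $\varphi_{u_0}+z\in B_{\mathcal{C}^{1,1}}(0,r)$, where $\epsilon(h,z)\to0$ in $C^0(I)$ as $h\to0$ in $\mathcal{C}^{1,1}(I)$ and $z\to0$ in $C^1(I)$. Therefore the map $u\in\mathcal{U}\mapsto\varphi_u\in C^0(I)$ is differentiable.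
   Context: $\mathcal{C}^{1,1}(I)$ is the Banach space of real-valued $C^1$ maps on $I$ with Lipschitz derivative, with norm $\|f\|_{1,1}=\max\Big(\|f\|_{C^1},\ \sup_{x,y\in I,\,x\ne y}\frac{|f'(x)-f'(y)|}{|x-y|}\Big)$, where $\|f\|_{C^1}=\max(\|f\|_\infty,\|f'\|_\infty)$. $B_{\mathcal{C}^{1,1}}(0,\rho)$ is the open ball of radius $\rho$ centered at $0$ in $\mathcal{C}^{1,1}(I)$. The map $F$ takes values in $\mathcal{C}^{1,1}(I)$ and is considered for $u\in\mathcal C^{1,1}(I)$ and for $\phi\in \mathcal C^{1,1}(I)$ with $\phi(I)\subset I$ (in particular for $\phi\in B_{\mathcal{C}^{1,1}}(0,r)$, $r<1$). "Contraction of $B_{\mathcal{C}^{1,1}}(0,r)$ in the $C^1$ topology" means that $F(u,\cdot)$ maps this ball to itself and $\|F(u,\phi)-F(u,\psi)\|_{C^1}\le k\|\phi-\psi\|_{C^1}$ on it, for some $k<1$ independent of $u\in\mathcal{U}$. Differentiability is in the Fréchet sense, from $\mathcal{U}\subset\mathcal{C}^{1,1}(I)$ to $C^0(I)$. *)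

theory Defs
  imports "HOL-Analysis.Analysis"
begin

abbreviation I :: "real set" where
  "I \<equiv> {-1..1}"

(* One-sided at the end points of I. *)
definition D :: "(real \<Rightarrow> real) \<Rightarrow> real \<Rightarrow> real" where
  "D f x = vector_derivative f (at x within I)"

definition sup_abs :: "'a set \<Rightarrow> ('a \<Rightarrow> real) \<Rightarrow> real" where
  "sup_abs A f = (SUP a\<in>A. \<bar>f a\<bar>)"

definition off_diag :: "(real \<times> real) set" where
  "off_diag = {(x, y). x \<in> I \<and> y \<in> I \<and> x \<noteq> y}"

definition dquot :: "(real \<Rightarrow> real) \<Rightarrow> real \<times> real \<Rightarrow> real" where
  "dquot f = (\<lambda>(x, y). (f x - f y) / (x - y))"

lemma D_eq:
  assumes "(f has_vector_derivative d) (at x within I)" "x \<in> I"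
  shows "D f x = d"
  unfolding D_def by (rule vector_derivative_within_closed_interval) (use assms in auto)

lemma has_D:
  assumes "f differentiable (at x within I)"
  shows "(f has_vector_derivative D f x) (at x within I)"
  unfolding D_def using assms by (simp add: vector_derivative_works)

lemma D_add:
  assumes "f differentiable (at x within I)" "g differentiable (at x within I)" "x \<in> I"
  shows "D (\<lambda>x. f x + g x) x = D f x + D g x"
  by (intro D_eq has_vector_derivative_add has_D assms)

lemma D_diff:
  assumes "f differentiable (at x within I)" "g differentiable (at x within I)" "x \<in> I"
  shows "D (\<lambda>x. f x - g x) x = D f x - D g x"
  by (intro D_eq has_vector_derivative_diff has_D assms)

lemma D_minus:
  assumes "f differentiable (at x within I)" "x \<in> I"
  shows "D (\<lambda>x. - f x) x = - D f x"
  by (intro D_eq has_vector_derivative_minus has_D assms)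

lemma D_cmult:
  assumes "f differentiable (at x within I)" "x \<in> I"
  shows "D (\<lambda>x. c * f x) x = c * D f x"
  by (intro D_eq has_vector_derivative_mult_right has_D assms)

lemma D_zero: "x \<in> I \<Longrightarrow> D (\<lambda>x. 0) x = 0"
  by (intro D_eq) auto

lemma D_comp:
  assumes "f differentiable (at (g x) within I)" "g differentiable (at x within I)"
    and "g ` I \<subseteq> I" "x \<in> I"
  shows "((\<lambda>x. f (g x)) has_vector_derivative D f (g x) * D g x) (at x within I)"
proof -
  have "(f has_vector_derivative D f (g x)) (at (g x) within g ` I)"
    using has_D[OF assms(1)] assms(3) has_vector_derivative_within_subset by blast
  from vector_diff_chain_within[OF has_D[OF assms(2)] this]
  show ?thesis by (simp add: o_def mult.commute)
qed

lemma continuous_on_D_cong: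
  "continuous_on I g \<Longrightarrow> (\<And>x. x \<in> I \<Longrightarrow> D f x = g x) \<Longrightarrow> continuous_on I (D f)"
  by (metis continuous_on_cong)

lemma lipschitz_on_D_cong:
  "L-lipschitz_on I g \<Longrightarrow> (\<And>x. x \<in> I \<Longrightarrow> D f x = g x) \<Longrightarrow> \<exists>L. L-lipschitz_on I (D f)"
  unfolding lipschitz_on_def by (metis (no_types, lifting))

lemma lipschitz_cmult_real:
  fixes f :: "real \<Rightarrow> real"
  assumes "L-lipschitz_on A f"
  shows "(\<bar>c\<bar> * L)-lipschitz_on A (\<lambda>x. c * f x)"
  using lipschitz_on_cmult_real[OF assms, of c] by simp

lemma continuous_on_D_add:
  assumes "\<forall>x\<in>I. f differentiable (at x within I)" "continuous_on I (D f)" and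
    "\<forall>x\<in>I. g differentiable (at x within I)" "continuous_on I (D g)"
  shows "continuous_on I (D (\<lambda>x. f x + g x))"
  by (rule continuous_on_D_cong[OF continuous_on_add[OF assms(2) assms(4)]]) (simp_all add: assms D_add)

lemma continuous_on_D_diff:
  assumes "\<forall>x\<in>I. f differentiable (at x within I)" "continuous_on I (D f)" and
    "\<forall>x\<in>I. g differentiable (at x within I)" "continuous_on I (D g)"
  shows "continuous_on I (D (\<lambda>x. f x - g x))"
  by (rule continuous_on_D_cong[OF continuous_on_diff[OF assms(2) assms(4)]]) (simp_all add: assms D_diff)

lemma continuous_on_D_minus:
  assumes "\<forall>x\<in>I. f differentiable (at x within I)" "continuous_on I (D f)"
  shows "continuous_on I (D (\<lambda>x. - f x))"
  by (rule continuous_on_D_cong[OF continuous_on_minus[OF assms(2)]]) (simp_all add: assms D_minus)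

lemma continuous_on_D_cmult:
  assumes "\<forall>x\<in>I. f differentiable (at x within I)" "continuous_on I (D f)"
  shows "continuous_on I (D (\<lambda>x. c * f x))"
  by (rule continuous_on_D_cong[OF continuous_on_mult_left[OF assms(2), of c]]) (simp_all add: assms D_cmult)

lemma lipschitz_on_D_add:
  assumes "\<forall>x\<in>I. f differentiable (at x within I)" "\<exists>L. L-lipschitz_on I (D f)" and
    "\<forall>x\<in>I. g differentiable (at x within I)" "\<exists>L. L-lipschitz_on I (D g)"
  shows "\<exists>L. L-lipschitz_on I (D (\<lambda>x. f x + g x))"
proof -
  obtain K L where "K-lipschitz_on I (D f)" "L-lipschitz_on I (D g)"
    using assms by blast
  from lipschitz_on_add[OF this] show ?thesis
    by (rule lipschitz_on_D_cong) (simp add: assms D_add)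
qed

lemma lipschitz_on_D_diff:
  assumes "\<forall>x\<in>I. f differentiable (at x within I)" "\<exists>L. L-lipschitz_on I (D f)" and
    "\<forall>x\<in>I. g differentiable (at x within I)" "\<exists>L. L-lipschitz_on I (D g)"
  shows "\<exists>L. L-lipschitz_on I (D (\<lambda>x. f x - g x))"
proof -
  obtain K L where "K-lipschitz_on I (D f)" "L-lipschitz_on I (D g)"
    using assms by blast
  from lipschitz_on_diff[OF this] show ?thesis
    by (rule lipschitz_on_D_cong) (simp add: assms D_diff)
qed

lemma lipschitz_on_D_minus:
  assumes "\<forall>x\<in>I. f differentiable (at x within I)" "\<exists>L. L-lipschitz_on I (D f)"
  shows "\<exists>L. L-lipschitz_on I (D (\<lambda>x. - f x))"
proof -
  obtain L where "L-lipschitz_on I (D f)"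
    using assms by blast
  from lipschitz_on_minus[OF this] show ?thesis
    by (rule lipschitz_on_D_cong) (simp add: assms D_minus)
qed

lemma lipschitz_on_D_cmult:
  assumes "\<forall>x\<in>I. f differentiable (at x within I)" "\<exists>L. L-lipschitz_on I (D f)"
  shows "\<exists>L. L-lipschitz_on I (D (\<lambda>x. c * f x))"
proof -
  obtain L where "L-lipschitz_on I (D f)"
    using assms by blast
  from lipschitz_cmult_real[OF this, of c] show ?thesis
    by (rule lipschitz_on_D_cong) (simp add: assms D_cmult)
qed

lemma sup_abs_cong: "(\<And>a. a \<in> A \<Longrightarrow> f a = g a) \<Longrightarrow> sup_abs A f = sup_abs A g"
  unfolding sup_abs_def by (auto cong: SUP_cong)

lemma sup_abs_upper:
  assumes "bounded (f ` A)" "a \<in> A"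
  shows "\<bar>f a\<bar> \<le> sup_abs A f"
proof -
  obtain B where "\<forall>x\<in>A. \<bar>f x\<bar> \<le> B"
    using assms(1) unfolding bounded_iff by auto
  then show ?thesis
    unfolding sup_abs_def using assms(2) by (intro cSUP_upper bdd_aboveI2) auto
qed

lemma sup_abs_least:
  assumes "A \<noteq> {}" "\<And>a. a \<in> A \<Longrightarrow> \<bar>f a\<bar> \<le> B"
  shows "sup_abs A f \<le> B"
  unfolding sup_abs_def using assms by (intro cSUP_least)

lemma sup_abs_nonneg: "bounded (f ` A) \<Longrightarrow> A \<noteq> {} \<Longrightarrow> 0 \<le> sup_abs A f"
  by (meson abs_ge_zero ex_in_conv order_trans sup_abs_upper)

lemma sup_abs_zero: "A \<noteq> {} \<Longrightarrow> sup_abs A (\<lambda>x. 0) = 0"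
  by (simp add: sup_abs_def)

lemma sup_abs_triangle:
  assumes "bounded (f ` A)" "bounded (g ` A)" "A \<noteq> {}"
  shows "sup_abs A (\<lambda>x. f x + g x) \<le> sup_abs A f + sup_abs A g"
proof (rule sup_abs_least[OF assms(3)])
  fix a assume "a \<in> A"
  then show "\<bar>f a + g a\<bar> \<le> sup_abs A f + sup_abs A g"
    using sup_abs_upper[OF assms(1)] sup_abs_upper[OF assms(2)] by (smt (verit))
qed

lemma sup_abs_cmult_le:
  assumes "bounded (f ` A)" "A \<noteq> {}"
  shows "sup_abs A (\<lambda>x. c * f x) \<le> \<bar>c\<bar> * sup_abs A f"
  by (rule sup_abs_least[OF assms(2)])
     (auto simp: abs_mult intro!: mult_left_mono sup_abs_upper assms)

lemma bounded_cmult: "bounded (f ` A) \<Longrightarrow> bounded ((\<lambda>x. c * f x) ` A)" for f :: "'a \<Rightarrow> real"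
  using bounded_scaling[of "f ` A" c] by (simp add: image_image)

lemma sup_abs_cmult:
  assumes "bounded (f ` A)" "A \<noteq> {}"
  shows "sup_abs A (\<lambda>x. c * f x) = \<bar>c\<bar> * sup_abs A f"
proof (cases "c = 0")
  case True
  then show ?thesis by (simp add: sup_abs_zero assms)
next
  case False
  have "sup_abs A (\<lambda>x. inverse c * (c * f x)) \<le> \<bar>inverse c\<bar> * sup_abs A (\<lambda>x. c * f x)"
    by (intro sup_abs_cmult_le bounded_cmult assms)
  moreover have "(\<lambda>x. inverse c * (c * f x)) = f"
    using False by auto
  ultimately have "\<bar>c\<bar> * sup_abs A f \<le> sup_abs A (\<lambda>x. c * f x)"
    using False by (simp add: field_simps)
  with sup_abs_cmult_le[OF assms, of c] show ?thesis by linarith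
qed

lemma I_nonempty: "I \<noteq> {}"
  by simp

lemma off_diag_nonempty: "off_diag \<noteq> {}"
proof -
  have "(0, 1) \<in> off_diag" by (simp add: off_diag_def)
  then show ?thesis by blast
qed

lemma bounded_continuous_I: "continuous_on I f \<Longrightarrow> bounded (f ` I)" for f :: "real \<Rightarrow> real"
  by (intro compact_imp_bounded compact_continuous_image) auto

lemma bounded_dquot:
  assumes "L-lipschitz_on I f"
  shows "bounded (dquot f ` off_diag)"
proof -
  have "\<bar>dquot f p\<bar> \<le> L" if "p \<in> off_diag" for p
    using that lipschitz_onD[OF assms, of "fst p" "snd p"]
    by (auto simp: off_diag_def dquot_def dist_real_def field_simps)
  then have "\<forall>y\<in>dquot f ` off_diag. norm y \<le> L" by auto
  then show ?thesis unfolding bounded_iff by blast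
qed

(* An element of a function space on I is represented by its extension by 0 outside I, which
   makes the representation unique; differentiability and continuity are meant relative to I. *)

typedef C0 = "{f :: real \<Rightarrow> real. continuous_on I f \<and> (\<forall>x. x \<notin> I \<longrightarrow> f x = 0)}"
  morphisms C0_fun Abs_C0
  by (rule exI[of _ "\<lambda>x. 0"]) auto

typedef C1 = "{f :: real \<Rightarrow> real. (\<forall>x\<in>I. f differentiable (at x within I)) \<and>
    continuous_on I (D f) \<and> (\<forall>x. x \<notin> I \<longrightarrow> f x = 0)}"
  morphisms C1_fun Abs_C1
  by (rule exI[of _ "\<lambda>x. 0"]) (auto intro!: continuous_on_D_cong[OF continuous_on_const] D_zero)

typedef C11 = "{f :: real \<Rightarrow> real. (\<forall>x\<in>I. f differentiable (at x within I)) \<and>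
    (\<exists>L. L-lipschitz_on I (D f)) \<and> (\<forall>x. x \<notin> I \<longrightarrow> f x = 0)}"
  morphisms C11_fun Abs_C11
proof (rule exI[of _ "\<lambda>x. 0"])
  have "0-lipschitz_on I (D (\<lambda>x. 0))"
    by (rule lipschitz_onI) (auto simp: D_zero)
  then show "(\<lambda>x. 0) \<in> {f :: real \<Rightarrow> real. (\<forall>x\<in>I. f differentiable (at x within I)) \<and>
      (\<exists>L. L-lipschitz_on I (D f)) \<and> (\<forall>x. x \<notin> I \<longrightarrow> f x = 0)}"
    by auto
qed

setup_lifting type_definition_C0
setup_lifting type_definition_C1
setup_lifting type_definition_C11

lemma C0_props:
  "continuous_on I (C0_fun f)" "x \<notin> I \<Longrightarrow> C0_fun f x = 0"
  using C0_fun[of f] by auto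

lemma C1_props:
  "x \<in> I \<Longrightarrow> C1_fun f differentiable (at x within I)" "continuous_on I (D (C1_fun f))"
  "x \<notin> I \<Longrightarrow> C1_fun f x = 0"
  using C1_fun[of f] by auto

lemma C11_props:
  "x \<in> I \<Longrightarrow> C11_fun f differentiable (at x within I)" "\<exists>L. L-lipschitz_on I (D (C11_fun f))"
  "x \<notin> I \<Longrightarrow> C11_fun f x = 0"
  using C11_fun[of f] by auto

lemma continuous_on_differentiable_I:
  "(\<And>x. x \<in> I \<Longrightarrow> f differentiable (at x within I)) \<Longrightarrow> continuous_on I f"
  for f :: "real \<Rightarrow> real"
  unfolding continuous_on_eq_continuous_within by (blast intro: differentiable_imp_continuous_within)

lemma C11_continuous:
  "continuous_on I (C11_fun f)" "continuous_on I (D (C11_fun f))"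
  using C11_props continuous_on_differentiable_I lipschitz_on_continuous_on by blast+

lemma C1_continuous: "continuous_on I (C1_fun f)"
  using C1_props continuous_on_differentiable_I by blast

lemma C0_bounded: "bounded (C0_fun f ` I)"
  by (intro bounded_continuous_I C0_props)

lemma C1_bounded: "bounded (C1_fun f ` I)" "bounded (D (C1_fun f) ` I)"
  by (intro bounded_continuous_I C1_props C1_continuous)+

lemma C11_bounded:
  "bounded (C11_fun f ` I)" "bounded (D (C11_fun f) ` I)"
  "bounded (dquot (D (C11_fun f)) ` off_diag)"
    apply (intro bounded_continuous_I C11_continuous)
   apply (intro bounded_continuous_I C11_continuous)
  using C11_props(2)[of f] bounded_dquot by blast


instantiation C0 :: real_normed_vector
begin

lift_definition zero_C0 :: C0 is "\<lambda>x. 0" by auto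

lift_definition plus_C0 :: "C0 \<Rightarrow> C0 \<Rightarrow> C0" is "\<lambda>f g x. f x + g x"
  by (auto intro!: continuous_intros)

lift_definition minus_C0 :: "C0 \<Rightarrow> C0 \<Rightarrow> C0" is "\<lambda>f g x. f x - g x"
  by (auto intro!: continuous_intros)

lift_definition uminus_C0 :: "C0 \<Rightarrow> C0" is "\<lambda>f x. - f x"
  by (auto intro!: continuous_intros)

lift_definition scaleR_C0 :: "real \<Rightarrow> C0 \<Rightarrow> C0" is "\<lambda>c f x. c * f x"
  by (auto intro!: continuous_intros)

definition norm_C0 :: "C0 \<Rightarrow> real" where
  "norm f = sup_abs I (C0_fun f)"

definition dist_C0 :: "C0 \<Rightarrow> C0 \<Rightarrow> real" where
  "dist (f :: C0) g = norm (f - g)"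

definition sgn_C0 :: "C0 \<Rightarrow> C0" where
  "sgn (f :: C0) = inverse (norm f) *\<^sub>R f"

definition uniformity_C0 :: "(C0 \<times> C0) filter" where
  "uniformity = (INF e\<in>{0<..}. principal {(f :: C0, g). dist f g < e})"

definition open_C0 :: "C0 set \<Rightarrow> bool" where
  "open (U :: C0 set) = (\<forall>f\<in>U. \<forall>\<^sub>F (f', g) in uniformity. f' = f \<longrightarrow> g \<in> U)"

instance
proof
  fix f g h :: C0 and a b :: real and U :: "C0 set"
  show "f + g + h = f + (g + h)" by transfer auto
  show "f + g = g + f" by transfer auto
  show "0 + f = f" by transfer auto
  show "- f + f = 0" by transfer auto
  show "f - g = f + - g" by transfer auto
  show "a *\<^sub>R (f + g) = a *\<^sub>R f + a *\<^sub>R g" by transfer (auto simp: algebra_simps)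
  show "(a + b) *\<^sub>R f = a *\<^sub>R f + b *\<^sub>R f" by transfer (auto simp: algebra_simps)
  show "a *\<^sub>R b *\<^sub>R f = (a * b) *\<^sub>R f" by transfer (auto simp: algebra_simps)
  show "1 *\<^sub>R f = f" by transfer auto
  show "dist f g = norm (f - g)" by (rule dist_C0_def)
  show "sgn f = inverse (norm f) *\<^sub>R f" by (rule sgn_C0_def)
  show "uniformity = (INF e\<in>{0<..}. principal {(f :: C0, g). dist f g < e})"
    by (rule uniformity_C0_def)
  show "open U = (\<forall>f\<in>U. \<forall>\<^sub>F (f', g) in uniformity. f' = f \<longrightarrow> g \<in> U)"
    by (rule open_C0_def)
  show "norm f = 0 \<longleftrightarrow> f = 0"
  proof
    assume "norm f = 0"
    then have "C0_fun f x = 0" if "x \<in> I" for x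
      using sup_abs_upper[OF C0_bounded that, of f] by (simp add: norm_C0_def)
    then have "C0_fun f x = 0" for x
      using C0_props(2) by blast
    then show "f = 0" by (simp add: C0_fun_inject[symmetric] zero_C0.rep_eq fun_eq_iff)
  qed (simp add: norm_C0_def zero_C0.rep_eq sup_abs_zero)
  show "norm (f + g) \<le> norm f + norm g"
    unfolding norm_C0_def plus_C0.rep_eq by (intro sup_abs_triangle C0_bounded I_nonempty)
  show "norm (a *\<^sub>R f) = \<bar>a\<bar> * norm f"
    unfolding norm_C0_def scaleR_C0.rep_eq by (intro sup_abs_cmult C0_bounded I_nonempty)
qed

end


instantiation C1 :: real_normed_vector
begin

lift_definition zero_C1 :: C1 is "\<lambda>x. 0"
  by (auto intro!: continuous_on_D_cong[OF continuous_on_const] D_zero)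

lift_definition plus_C1 :: "C1 \<Rightarrow> C1 \<Rightarrow> C1" is "\<lambda>f g x. f x + g x"
  by (auto intro!: continuous_on_D_add)

lift_definition minus_C1 :: "C1 \<Rightarrow> C1 \<Rightarrow> C1" is "\<lambda>f g x. f x - g x"
  by (auto intro!: continuous_on_D_diff)

lift_definition uminus_C1 :: "C1 \<Rightarrow> C1" is "\<lambda>f x. - f x"
  by (auto intro!: continuous_on_D_minus)

lift_definition scaleR_C1 :: "real \<Rightarrow> C1 \<Rightarrow> C1" is "\<lambda>c f x. c * f x"
  by (auto intro!: continuous_on_D_cmult)

definition norm_C1 :: "C1 \<Rightarrow> real" where
  "norm f = max (sup_abs I (C1_fun f)) (sup_abs I (D (C1_fun f)))"

definition dist_C1 :: "C1 \<Rightarrow> C1 \<Rightarrow> real" where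
  "dist (f :: C1) g = norm (f - g)"

definition sgn_C1 :: "C1 \<Rightarrow> C1" where
  "sgn (f :: C1) = inverse (norm f) *\<^sub>R f"

definition uniformity_C1 :: "(C1 \<times> C1) filter" where
  "uniformity = (INF e\<in>{0<..}. principal {(f :: C1, g). dist f g < e})"

definition open_C1 :: "C1 set \<Rightarrow> bool" where
  "open (U :: C1 set) = (\<forall>f\<in>U. \<forall>\<^sub>F (f', g) in uniformity. f' = f \<longrightarrow> g \<in> U)"

instance
proof
  fix f g h :: C1 and a b :: real and U :: "C1 set"
  show "f + g + h = f + (g + h)" by transfer auto
  show "f + g = g + f" by transfer auto
  show "0 + f = f" by transfer auto
  show "- f + f = 0" by transfer auto
  show "f - g = f + - g" by transfer auto
  show "a *\<^sub>R (f + g) = a *\<^sub>R f + a *\<^sub>R g" by transfer (auto simp: algebra_simps)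
  show "(a + b) *\<^sub>R f = a *\<^sub>R f + b *\<^sub>R f" by transfer (auto simp: algebra_simps)
  show "a *\<^sub>R b *\<^sub>R f = (a * b) *\<^sub>R f" by transfer (auto simp: algebra_simps)
  show "1 *\<^sub>R f = f" by transfer auto
  show "dist f g = norm (f - g)" by (rule dist_C1_def)
  show "sgn f = inverse (norm f) *\<^sub>R f" by (rule sgn_C1_def)
  show "uniformity = (INF e\<in>{0<..}. principal {(f :: C1, g). dist f g < e})"
    by (rule uniformity_C1_def)
  show "open U = (\<forall>f\<in>U. \<forall>\<^sub>F (f', g) in uniformity. f' = f \<longrightarrow> g \<in> U)"
    by (rule open_C1_def)
  show "norm f = 0 \<longleftrightarrow> f = 0"
  proof
    assume "norm f = 0"
    then have "C1_fun f x = 0" if "x \<in> I" for x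
      using sup_abs_upper[OF C1_bounded(1) that, of f] by (simp add: norm_C1_def max_def split: if_splits)
    then have "C1_fun f x = 0" for x
      using C1_props(3) by blast
    then show "f = 0" by (simp add: C1_fun_inject[symmetric] zero_C1.rep_eq fun_eq_iff)
  next
    assume "f = 0"
    moreover have "sup_abs I (D (\<lambda>x. 0)) = 0"
      using sup_abs_cong[of I "D (\<lambda>x. 0)" "\<lambda>x. 0"] D_zero sup_abs_zero[OF I_nonempty] by simp
    ultimately show "norm f = 0"
      by (simp add: norm_C1_def zero_C1.rep_eq sup_abs_zero)
  qed
  have 1: "sup_abs I (D (C1_fun (f + g))) = sup_abs I (\<lambda>x. D (C1_fun f) x + D (C1_fun g) x)"
    by (rule sup_abs_cong) (simp add: plus_C1.rep_eq D_add C1_props(1))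
  show "norm (f + g) \<le> norm f + norm g"
    using sup_abs_triangle[OF C1_bounded(1) C1_bounded(1) I_nonempty, of f g]
      sup_abs_triangle[OF C1_bounded(2) C1_bounded(2) I_nonempty, of f g]
    unfolding norm_C1_def 1 unfolding plus_C1.rep_eq by linarith
  have 1: "sup_abs I (D (C1_fun (a *\<^sub>R f))) = sup_abs I (\<lambda>x. a * D (C1_fun f) x)"
    by (rule sup_abs_cong) (simp add: scaleR_C1.rep_eq D_cmult C1_props(1))
  show "norm (a *\<^sub>R f) = \<bar>a\<bar> * norm f"
    using sup_abs_cmult[OF C1_bounded(1) I_nonempty, of a f]
      sup_abs_cmult[OF C1_bounded(2) I_nonempty, of a f]
    unfolding norm_C1_def 1 unfolding scaleR_C1.rep_eq by (simp add: max_mult_distrib_left)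
qed

end


lemma C11_D_ops:
  "x \<in> I \<Longrightarrow> D (\<lambda>x. C11_fun f x + C11_fun g x) x = D (C11_fun f) x + D (C11_fun g) x"
  "x \<in> I \<Longrightarrow> D (\<lambda>x. C11_fun f x - C11_fun g x) x = D (C11_fun f) x - D (C11_fun g) x"
  "x \<in> I \<Longrightarrow> D (\<lambda>x. - C11_fun f x) x = - D (C11_fun f) x"
  "x \<in> I \<Longrightarrow> D (\<lambda>x. c * C11_fun f x) x = c * D (C11_fun f) x"
  by (simp_all add: D_add D_diff D_minus D_cmult C11_props(1))

lemma dquot_cong:
  "(\<And>x. x \<in> I \<Longrightarrow> f x = g x) \<Longrightarrow> p \<in> off_diag \<Longrightarrow> dquot f p = dquot g p"
  by (auto simp: dquot_def off_diag_def)

lemma dquot_ops: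
  "dquot (\<lambda>x. f x + g x) p = dquot f p + dquot g p"
  "dquot (\<lambda>x. c * f x) p = c * dquot f p"
  "dquot (\<lambda>x. 0) p = 0"
  by (auto simp: dquot_def diff_divide_distrib add_divide_distrib algebra_simps split: prod.splits)


instantiation C11 :: real_normed_vector
begin

lift_definition zero_C11 :: C11 is "\<lambda>x. 0"
  by (auto intro!: exI[of _ 0] lipschitz_onI simp: D_zero)

lift_definition plus_C11 :: "C11 \<Rightarrow> C11 \<Rightarrow> C11" is "\<lambda>f g x. f x + g x"
  by (auto intro!: lipschitz_on_D_add)

lift_definition minus_C11 :: "C11 \<Rightarrow> C11 \<Rightarrow> C11" is "\<lambda>f g x. f x - g x"
  by (auto intro!: lipschitz_on_D_diff)

lift_definition uminus_C11 :: "C11 \<Rightarrow> C11" is "\<lambda>f x. - f x"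
  by (auto intro!: lipschitz_on_D_minus)

lift_definition scaleR_C11 :: "real \<Rightarrow> C11 \<Rightarrow> C11" is "\<lambda>c f x. c * f x"
  by (auto intro!: lipschitz_on_D_cmult)

definition norm_C11 :: "C11 \<Rightarrow> real" where
  "norm f = max (max (sup_abs I (C11_fun f)) (sup_abs I (D (C11_fun f))))
                (sup_abs off_diag (dquot (D (C11_fun f))))"

definition dist_C11 :: "C11 \<Rightarrow> C11 \<Rightarrow> real" where
  "dist (f :: C11) g = norm (f - g)"

definition sgn_C11 :: "C11 \<Rightarrow> C11" where
  "sgn (f :: C11) = inverse (norm f) *\<^sub>R f"

definition uniformity_C11 :: "(C11 \<times> C11) filter" where
  "uniformity = (INF e\<in>{0<..}. principal {(f :: C11, g). dist f g < e})"

definition open_C11 :: "C11 set \<Rightarrow> bool" where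
  "open (U :: C11 set) = (\<forall>f\<in>U. \<forall>\<^sub>F (f', g) in uniformity. f' = f \<longrightarrow> g \<in> U)"

instance
proof
  fix f g h :: C11 and a b :: real and U :: "C11 set"
  show "f + g + h = f + (g + h)" by transfer auto
  show "f + g = g + f" by transfer auto
  show "0 + f = f" by transfer auto
  show "- f + f = 0" by transfer auto
  show "f - g = f + - g" by transfer auto
  show "a *\<^sub>R (f + g) = a *\<^sub>R f + a *\<^sub>R g" by transfer (auto simp: algebra_simps)
  show "(a + b) *\<^sub>R f = a *\<^sub>R f + b *\<^sub>R f" by transfer (auto simp: algebra_simps)
  show "a *\<^sub>R b *\<^sub>R f = (a * b) *\<^sub>R f" by transfer (auto simp: algebra_simps)
  show "1 *\<^sub>R f = f" by transfer auto
  show "dist f g = norm (f - g)" by (rule dist_C11_def)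
  show "sgn f = inverse (norm f) *\<^sub>R f" by (rule sgn_C11_def)
  show "uniformity = (INF e\<in>{0<..}. principal {(f :: C11, g). dist f g < e})"
    by (rule uniformity_C11_def)
  show "open U = (\<forall>f\<in>U. \<forall>\<^sub>F (f', g) in uniformity. f' = f \<longrightarrow> g \<in> U)"
    by (rule open_C11_def)
  show "norm f = 0 \<longleftrightarrow> f = 0"
  proof
    assume "norm f = 0"
    then have "C11_fun f x = 0" if "x \<in> I" for x
      using sup_abs_upper[OF C11_bounded(1) that, of f] by (simp add: norm_C11_def max_def split: if_splits)
    then have "C11_fun f x = 0" for x
      using C11_props(3) by blast
    then show "f = 0" by (simp add: C11_fun_inject[symmetric] zero_C11.rep_eq fun_eq_iff)
  next
    assume "f = 0"
    moreover have "sup_abs I (D (\<lambda>x. 0)) = 0"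
      using sup_abs_cong[of I "D (\<lambda>x. 0)" "\<lambda>x. 0"] D_zero sup_abs_zero[OF I_nonempty] by simp
    moreover have "sup_abs off_diag (dquot (D (\<lambda>x. 0))) = 0"
      using sup_abs_cong[of off_diag "dquot (D (\<lambda>x. 0))" "\<lambda>x. 0"]
        dquot_cong[of "D (\<lambda>x. 0)" "\<lambda>x. 0"] D_zero sup_abs_zero[OF off_diag_nonempty]
      by (simp add: dquot_ops)
    ultimately show "norm f = 0"
      by (simp add: norm_C11_def zero_C11.rep_eq sup_abs_zero)
  qed
  have 1: "sup_abs I (D (C11_fun (f + g))) = sup_abs I (\<lambda>x. D (C11_fun f) x + D (C11_fun g) x)"
    by (rule sup_abs_cong) (simp add: plus_C11.rep_eq C11_D_ops)
  have 2: "sup_abs off_diag (dquot (D (C11_fun (f + g)))) =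
      sup_abs off_diag (\<lambda>p. dquot (D (C11_fun f)) p + dquot (D (C11_fun g)) p)"
    unfolding dquot_ops[symmetric]
    by (rule sup_abs_cong, rule dquot_cong) (simp_all add: plus_C11.rep_eq C11_D_ops)
  show "norm (f + g) \<le> norm f + norm g"
    using sup_abs_triangle[OF C11_bounded(1) C11_bounded(1) I_nonempty, of f g]
      sup_abs_triangle[OF C11_bounded(2) C11_bounded(2) I_nonempty, of f g]
      sup_abs_triangle[OF C11_bounded(3) C11_bounded(3) off_diag_nonempty, of f g]
    unfolding norm_C11_def 1 2 unfolding plus_C11.rep_eq by linarith
  have 1: "sup_abs I (D (C11_fun (a *\<^sub>R f))) = sup_abs I (\<lambda>x. a * D (C11_fun f) x)"
    by (rule sup_abs_cong) (simp add: scaleR_C11.rep_eq C11_D_ops)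
  have 2: "sup_abs off_diag (dquot (D (C11_fun (a *\<^sub>R f)))) =
      sup_abs off_diag (\<lambda>p. a * dquot (D (C11_fun f)) p)"
    unfolding dquot_ops[symmetric]
    by (rule sup_abs_cong, rule dquot_cong) (simp_all add: scaleR_C11.rep_eq C11_D_ops)
  show "norm (a *\<^sub>R f) = \<bar>a\<bar> * norm f"
    using sup_abs_cmult[OF C11_bounded(1) I_nonempty, of a f]
      sup_abs_cmult[OF C11_bounded(2) I_nonempty, of a f]
      sup_abs_cmult[OF C11_bounded(3) off_diag_nonempty, of a f]
    unfolding norm_C11_def 1 2 unfolding scaleR_C11.rep_eq by (simp add: max_mult_distrib_left)
qed

end


lift_definition C1_to_C0 :: "C1 \<Rightarrow> C0" is "\<lambda>f. f"
  using continuous_on_differentiable_I by auto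

lift_definition C11_to_C1 :: "C11 \<Rightarrow> C1" is "\<lambda>f. f"
  using lipschitz_on_continuous_on by auto

definition C11_to_C0 :: "C11 \<Rightarrow> C0" where
  "C11_to_C0 f = C1_to_C0 (C11_to_C1 f)"

lemma comp_lipschitz:
  fixes f g :: "real \<Rightarrow> real"
  assumes f: "\<And>x. x \<in> I \<Longrightarrow> f differentiable (at x within I)" "\<exists>L. L-lipschitz_on I (D f)"
    and g: "\<And>x. x \<in> I \<Longrightarrow> g differentiable (at x within I)" "\<exists>L. L-lipschitz_on I (D g)"
    and gI: "g ` I \<subseteq> I"
  shows "\<exists>L. L-lipschitz_on I (\<lambda>x. D f (g x) * D g x)"
proof -
  obtain K L where K: "K-lipschitz_on I (D f)" and L: "L-lipschitz_on I (D g)"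
    using f g by blast
  have KL: "0 \<le> K" "0 \<le> L" using K L lipschitz_on_nonneg by blast+
  define M N where "M = sup_abs I (D f)" and "N = sup_abs I (D g)"
  have M: "\<bar>D f x\<bar> \<le> M" and N: "\<bar>D g x\<bar> \<le> N" if "x \<in> I" for x
    unfolding M_def N_def using that K L
    by (auto intro!: sup_abs_upper bounded_continuous_I lipschitz_on_continuous_on)
  have MN: "0 \<le> M" "0 \<le> N" using M[of 0] N[of 0] by auto
  have gx: "\<bar>g x - g y\<bar> \<le> N * \<bar>x - y\<bar>" if "x \<in> I" "y \<in> I" for x y
  proof -
    have "norm (g x - g y) \<le> N * norm (x - y)"
    proof (rule field_differentiable_bound[of I g "D g"])
      show "(g has_field_derivative D g z) (at z within I)" if "z \<in> I" for z
        using has_D[OF g(1)[OF that]] by (simp add: has_real_derivative_iff_has_vector_derivative)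
    qed (use that N in auto)
    then show ?thesis by simp
  qed
  have "(K * N * N + M * L)-lipschitz_on I (\<lambda>x. D f (g x) * D g x)"
  proof (rule lipschitz_onI)
    fix x y assume xy: "x \<in> I" "y \<in> I"
    then have gxy: "g x \<in> I" "g y \<in> I" using gI by blast+
    have a: "\<bar>D f (g x) - D f (g y)\<bar> \<le> K * (N * \<bar>x - y\<bar>)"
      using lipschitz_onD[OF K gxy] mult_left_mono[OF gx[OF xy] KL(1)] by (simp add: dist_real_def)
    have b: "\<bar>D g x - D g y\<bar> \<le> L * \<bar>x - y\<bar>"
      using lipschitz_onD[OF L xy] by (simp add: dist_real_def)
    have "D f (g x) * D g x - D f (g y) * D g y
        = (D f (g x) - D f (g y)) * D g x + D f (g y) * (D g x - D g y)"
      by (simp add: algebra_simps)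
    also have "\<bar>\<dots>\<bar> \<le> \<bar>D f (g x) - D f (g y)\<bar> * \<bar>D g x\<bar> + \<bar>D f (g y)\<bar> * \<bar>D g x - D g y\<bar>"
      by (metis abs_mult abs_triangle_ineq)
    also have "\<dots> \<le> K * (N * \<bar>x - y\<bar>) * N + M * (L * \<bar>x - y\<bar>)"
      by (intro add_mono mult_mono a b M N gxy xy) (use KL MN in auto)
    finally show "dist (D f (g x) * D g x) (D f (g y) * D g y) \<le> (K * N * N + M * L) * dist x y"
      by (simp add: dist_real_def algebra_simps)
  qed (use KL MN in auto)
  then show ?thesis ..
qed

(* Only meaningful when g maps I into I; the value is 0 by convention otherwise. *)
lift_definition comp_C11 :: "C11 \<Rightarrow> C11 \<Rightarrow> C11" is
  "\<lambda>f g x. if g ` I \<subseteq> I \<and> x \<in> I then f (g x) else 0"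
proof -
  fix f g :: "real \<Rightarrow> real"
  let ?S = "\<lambda>f. (\<forall>x\<in>I. f differentiable (at x within I)) \<and>
    (\<exists>L. L-lipschitz_on I (D f)) \<and> (\<forall>x. x \<notin> I \<longrightarrow> f x = (0 :: real))"
  let ?h = "\<lambda>x. if g ` I \<subseteq> I \<and> x \<in> I then f (g x) else 0"
  assume f: "?S f" and g: "?S g"
  show "?S ?h"
  proof (cases "g ` I \<subseteq> I")
    case True
    have d: "(?h has_vector_derivative D f (g x) * D g x) (at x within I)" if "x \<in> I" for x
    proof -
      have "g x \<in> I" using that True by blast
      then have "((\<lambda>x. f (g x)) has_vector_derivative D f (g x) * D g x) (at x within I)"
        using f g True that by (intro D_comp) auto
      then show ?thesis
        by (rule has_vector_derivative_transform[rotated 2]) (use True that in auto)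
    qed
    then have "\<forall>x\<in>I. ?h differentiable (at x within I)"
      using differentiableI_vector by blast
    moreover have "\<exists>L. L-lipschitz_on I (D ?h)"
    proof -
      obtain L where "L-lipschitz_on I (\<lambda>x. D f (g x) * D g x)"
        using comp_lipschitz[of f g] f g True by blast
      moreover have "D ?h x = D f (g x) * D g x" if "x \<in> I" for x
        by (rule D_eq[OF d[OF that] that])
      ultimately have "L-lipschitz_on I (D ?h)"
        unfolding lipschitz_on_def by (metis (no_types, lifting))
      then show ?thesis ..
    qed
    ultimately show ?thesis by simp
  next
    case False
    then have "?h = (\<lambda>x. 0)" by auto
    moreover have "0-lipschitz_on I (D (\<lambda>x. 0))"
      by (rule lipschitz_onI) (auto simp: D_zero)
    ultimately show ?thesis by auto
  qed
qed

definition F :: "C11 \<Rightarrow> C11 \<Rightarrow> C11" where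
  "F u \<phi> = (1/2) *\<^sub>R comp_C11 \<phi> \<phi> + u"

lemma C11_fun_ball:
  assumes "\<phi> \<in> ball 0 r" "r \<le> 1"
  shows "C11_fun \<phi> ` I \<subseteq> I"
proof -
  have "\<bar>C11_fun \<phi> x\<bar> \<le> 1" if "x \<in> I" for x
    using sup_abs_upper[OF C11_bounded(1) that, of \<phi>] assms by (simp add: norm_C11_def)
  then show ?thesis by force
qed

lemma F_apply:
  assumes "C11_fun \<phi> ` I \<subseteq> I" "x \<in> I"
  shows "C11_fun (F u \<phi>) x = 1/2 * C11_fun \<phi> (C11_fun \<phi> x) + C11_fun u x"
  using assms by (simp add: F_def plus_C11.rep_eq scaleR_C11.rep_eq comp_C11.rep_eq)

end

theory Submission
  imports Defs
begin

text \<open>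
  The numbers \<open>r = 1/2\<close>, \<open>r' = 1/4\<close> and \<open>k = 3/4\<close> work. If \<open>f\<close> has
  \<open>C\<^sup>1\<^sup>,\<^sup>1\<close> norm \<open>s\<close>, then \<open>f \<circ> f\<close> is bounded by \<open>s\<close>, its
  derivative by \<open>s\<^sup>2\<close>, and the Lipschitz constant of its derivative by \<open>s\<^sup>2 (1 + s)\<close>;
  for \<open>s \<le> 1/2\<close> all three are at most \<open>s\<close> (\<open>norm_comp_C11_self_le\<close>). So
  \<open>F u\<close> maps the ball of radius \<open>1/2\<close> to itself, and also the smaller closed ball of
  radius \<open>2 * norm u\<close>. On the ball of radius \<open>1/2\<close> self-composition has Lipschitz constant
  \<open>3/2\<close>, both in \<open>C\<^sup>0\<close> and in \<open>C\<^sup>1\<close>; the \<open>C\<^sup>1\<close> estimate uses the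
  Lipschitz bound on the derivatives. With the factor \<open>1/2\<close> in \<open>F\<close>, the map \<open>F u\<close>
  contracts both norms by \<open>3/4\<close>.

  Closed balls of \<open>C\<^sup>1\<^sup>,\<^sup>1\<close> are complete for the \<open>C\<^sup>1\<close> distance
  (\<open>complete_cball_C11_in_C1\<close>), so Banach's theorem gives the fixed point. Since the contraction
  factor is uniform in \<open>u\<close>, the fixed point is Lipschitz in \<open>u\<close> with constant
  \<open>1 / (1 - 3/4) = 4\<close>, in \<open>C\<^sup>1\<close> and in \<open>C\<^sup>0\<close>.

  For the development at \<open>f = \<phi> u\<^sub>0\<close>, take for \<open>P\<close> the inclusion and
  \<open>Q z = ((f' \<circ> f) * z + z \<circ> f) / 2\<close>. Twice the remainder is
  \[ (f \<circ> (f + z) - f \<circ> f - (f' \<circ> f) * z) + (z \<circ> (f + z) - z \<circ> f), \]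
  where Taylor's formula bounds the first bracket by a multiple of \<open>\<bar>z\<bar>\<^sup>2\<close> and the mean
  value theorem bounds the second by \<open>\<parallel>z'\<parallel> \<bar>z\<bar>\<close>. Hence the remainder is at most the
  \<open>C\<^sup>0\<close> norm of \<open>z\<close> times its \<open>C\<^sup>1\<close> norm (\<open>F_expansion\<close>): one
  derivative of \<open>z\<close> is lost, which is why two spaces are needed.

  Finally \<open>Q\<close> has \<open>C\<^sup>0\<close> norm at most \<open>3/4\<close>, so \<open>1 - Q\<close> is invertible on the
  Banach space \<open>C\<^sup>0\<close>. The increment \<open>z = \<phi> (u\<^sub>0 + h) - \<phi> u\<^sub>0\<close> satisfies
  \<open>(1 - Q) z = P h + R\<close> with \<open>R\<close> quadratic in \<open>h\<close>, by the Lipschitz dependence in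
  both norms. Therefore \<open>h \<mapsto> (1 - Q)\<^sup>-\<^sup>1 (P h)\<close> is the derivative.
\<close>

section \<open>The three norms and the inclusions between the spaces\<close>

lemma abs_C0_fun_le_norm: "x \<in> I \<Longrightarrow> \<bar>C0_fun f x\<bar> \<le> norm f"
  unfolding norm_C0_def by (intro sup_abs_upper C0_bounded)

lemma norm_C0_leI: "(\<And>x. x \<in> I \<Longrightarrow> \<bar>C0_fun f x\<bar> \<le> B) \<Longrightarrow> norm f \<le> B"
  unfolding norm_C0_def by (intro sup_abs_least I_nonempty)

lemma abs_C1_fun_le_norm:
  assumes "x \<in> I"
  shows "\<bar>C1_fun f x\<bar> \<le> norm f" "\<bar>D (C1_fun f) x\<bar> \<le> norm f"
  using sup_abs_upper[OF C1_bounded(1) assms, of f] sup_abs_upper[OF C1_bounded(2) assms, of f]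
  unfolding norm_C1_def by auto

lemma norm_C1_leI:
  assumes "\<And>x. x \<in> I \<Longrightarrow> \<bar>C1_fun f x\<bar> \<le> B" "\<And>x. x \<in> I \<Longrightarrow> \<bar>D (C1_fun f) x\<bar> \<le> B"
  shows "norm f \<le> B"
  unfolding norm_C1_def by (intro max.boundedI sup_abs_least I_nonempty assms)

lemma abs_C11_fun_le_norm:
  assumes "x \<in> I"
  shows "\<bar>C11_fun f x\<bar> \<le> norm f" "\<bar>D (C11_fun f) x\<bar> \<le> norm f"
  using sup_abs_upper[OF C11_bounded(1) assms, of f] sup_abs_upper[OF C11_bounded(2) assms, of f]
  unfolding norm_C11_def by auto

lemma D_C11_lipschitz:
  assumes "x \<in> I" "y \<in> I"
  shows "\<bar>D (C11_fun f) x - D (C11_fun f) y\<bar> \<le> norm f * \<bar>x - y\<bar>"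
proof (cases "x = y")
  case False
  then have "(x, y) \<in> off_diag" using assms by (simp add: off_diag_def)
  from sup_abs_upper[OF C11_bounded(3) this, of f]
  have "\<bar>dquot (D (C11_fun f)) (x, y)\<bar> \<le> norm f" unfolding norm_C11_def by auto
  then show ?thesis using False by (simp add: dquot_def field_simps)
qed simp

lemma norm_C11_leI:
  assumes "\<And>x. x \<in> I \<Longrightarrow> \<bar>C11_fun f x\<bar> \<le> B" "\<And>x. x \<in> I \<Longrightarrow> \<bar>D (C11_fun f) x\<bar> \<le> B"
    and lip: "\<And>x y. x \<in> I \<Longrightarrow> y \<in> I \<Longrightarrow> \<bar>D (C11_fun f) x - D (C11_fun f) y\<bar> \<le> B * \<bar>x - y\<bar>"
  shows "norm f \<le> B"
proof -
  have "\<bar>dquot (D (C11_fun f)) p\<bar> \<le> B" if "p \<in> off_diag" for p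
    using that lip[of "fst p" "snd p"] by (auto simp: off_diag_def dquot_def field_simps)
  then show ?thesis
    unfolding norm_C11_def
    by (intro max.boundedI sup_abs_least I_nonempty off_diag_nonempty assms)
qed

lemma C11_to_C0_fun: "C0_fun (C11_to_C0 f) = C11_fun f"
  by (simp add: C11_to_C0_def C1_to_C0.rep_eq C11_to_C1.rep_eq)

lemma norm_C11_to_C1_le: "norm (C11_to_C1 f) \<le> norm f"
  by (rule norm_C1_leI) (simp_all only: C11_to_C1.rep_eq abs_C11_fun_le_norm)

lemma bounded_linear_C11_to_C1: "bounded_linear C11_to_C1"
proof (rule bounded_linear_intro)
  show "C11_to_C1 (f + g) = C11_to_C1 f + C11_to_C1 g" for f g by transfer simp
  show "C11_to_C1 (c *\<^sub>R f) = c *\<^sub>R C11_to_C1 f" for c f by transfer simp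
  show "norm (C11_to_C1 f) \<le> norm f * 1" for f
    by (simp add: norm_C11_to_C1_le)
qed

lemma bounded_linear_C1_to_C0: "bounded_linear C1_to_C0"
proof (rule bounded_linear_intro)
  show "C1_to_C0 (f + g) = C1_to_C0 f + C1_to_C0 g" for f g by transfer simp
  show "C1_to_C0 (c *\<^sub>R f) = c *\<^sub>R C1_to_C0 f" for c f by transfer simp
  show "norm (C1_to_C0 f) \<le> norm f * 1" for f
    by (rule norm_C0_leI) (simp only: C1_to_C0.rep_eq mult_1_right abs_C1_fun_le_norm)
qed

lemma bounded_linear_C11_to_C0: "bounded_linear C11_to_C0"
  unfolding C11_to_C0_def
  by (rule bounded_linear_compose[OF bounded_linear_C1_to_C0 bounded_linear_C11_to_C1])

lemmas C11_to_C1_diff = bounded_linear.linear[OF bounded_linear_C11_to_C1, THEN linear_diff]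
lemmas C11_to_C0_diff = bounded_linear.linear[OF bounded_linear_C11_to_C0, THEN linear_diff]

lemma norm_C11_to_C0_le: "norm (C11_to_C0 f) \<le> norm f"
  by (rule norm_C0_leI) (simp only: C11_to_C0_fun abs_C11_fun_le_norm)

lemma inj_C11_to_C1: "inj C11_to_C1"
  by (rule injI) (simp add: C1_fun_inject[symmetric] C11_to_C1.rep_eq C11_fun_inject)

section \<open>Mean value estimates\<close>

lemma C11_has_field_derivative:
  "x \<in> I \<Longrightarrow> (C11_fun f has_field_derivative D (C11_fun f) x) (at x within I)"
  using has_D[OF C11_props(1)] by (simp add: has_real_derivative_iff_has_vector_derivative)

lemma C11_mean_value:
  assumes "\<And>t. t \<in> I \<Longrightarrow> \<bar>D (C11_fun f) t\<bar> \<le> B" "x \<in> I" "y \<in> I"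
  shows "\<bar>C11_fun f x - C11_fun f y\<bar> \<le> B * \<bar>x - y\<bar>"
  using field_differentiable_bound[of I "C11_fun f" "D (C11_fun f)" B x y]
    C11_has_field_derivative assms by simp

text \<open>The function \<open>t \<mapsto> f t - f' x * t\<close> has a derivative of size at most
  \<open>norm f * \<bar>y - x\<bar>\<close> between \<open>x\<close> and \<open>y\<close>. This is where the Lipschitz
  derivative turns the first-order Taylor remainder into a quadratic one.\<close>

lemma C11_taylor:
  assumes "x \<in> I" "y \<in> I"
  shows "\<bar>C11_fun f y - C11_fun f x - D (C11_fun f) x * (y - x)\<bar> \<le> norm f * \<bar>y - x\<bar>\<^sup>2"
proof -
  let ?S = "closed_segment x y"
  let ?d = "\<lambda>t. D (C11_fun f) t - D (C11_fun f) x"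
  have SI: "?S \<subseteq> I"
    using assms by (intro closed_segment_subset) auto
  have "norm ((C11_fun f y - D (C11_fun f) x * y) - (C11_fun f x - D (C11_fun f) x * x))
      \<le> (norm f * \<bar>y - x\<bar>) * norm (y - x)"
  proof (rule field_differentiable_bound[of ?S _ ?d])
    fix t assume t: "t \<in> ?S"
    then have tI: "t \<in> I" using SI by blast
    show "((\<lambda>t. C11_fun f t - D (C11_fun f) x * t) has_field_derivative ?d t) (at t within ?S)"
      by (rule DERIV_subset[OF _ SI])
        (auto intro!: derivative_eq_intros C11_has_field_derivative[OF tI])
    have "\<bar>t - x\<bar> \<le> \<bar>y - x\<bar>"
      using t by (auto simp: closed_segment_eq_real_ivl split: if_splits)
    with D_C11_lipschitz[OF tI assms(1), of f] show "norm (?d t) \<le> norm f * \<bar>y - x\<bar>"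
      by (smt (verit) mult_left_mono norm_ge_zero real_norm_def)
  qed auto
  moreover have "C11_fun f y - D (C11_fun f) x * y - (C11_fun f x - D (C11_fun f) x * x)
      = C11_fun f y - C11_fun f x - D (C11_fun f) x * (y - x)"
    by (simp add: algebra_simps)
  ultimately show ?thesis
    by (simp add: power2_eq_square mult.assoc)
qed

section \<open>Completeness\<close>

instance C0 :: banach
proof
  fix X :: "nat \<Rightarrow> C0" assume X: "Cauchy X"
  have "uniformly_Cauchy_on I (\<lambda>n. C0_fun (X n))"
    unfolding uniformly_Cauchy_on_def
  proof (intro allI impI)
    fix e :: real assume "0 < e"
    then obtain M where M: "\<And>m n. M \<le> m \<Longrightarrow> M \<le> n \<Longrightarrow> dist (X m) (X n) < e"
      using X unfolding Cauchy_def by blast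
    have "dist (C0_fun (X m) x) (C0_fun (X n) x) < e" if "x \<in> I" "M \<le> m" "M \<le> n" for x m n
      using abs_C0_fun_le_norm[OF that(1), of "X m - X n"] M[OF that(2,3)]
      by (simp add: minus_C0.rep_eq dist_norm)
    then show "\<exists>M. \<forall>x\<in>I. \<forall>m\<ge>M. \<forall>n\<ge>M. dist (C0_fun (X m) x) (C0_fun (X n) x) < e"
      by blast
  qed
  then obtain l where l: "uniform_limit I (\<lambda>n. C0_fun (X n)) l sequentially"
    using Cauchy_uniformly_convergent unfolding uniformly_convergent_on_def by blast
  have "continuous_on I l"
    by (rule uniform_limit_theorem[OF _ l]) (simp_all add: C0_props(1))
  then have cont: "continuous_on I (\<lambda>x. if x \<in> I then l x else 0)"
    by (rule continuous_on_eq) auto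
  define L where "L = Abs_C0 (\<lambda>x. if x \<in> I then l x else 0)"
  have L: "C0_fun L = (\<lambda>x. if x \<in> I then l x else 0)"
    unfolding L_def using cont by (subst Abs_C0_inverse) auto
  have "X \<longlonglongrightarrow> L"
    unfolding lim_sequentially
  proof (intro allI impI)
    fix e :: real assume "0 < e"
    then obtain N where N: "\<And>n x. N \<le> n \<Longrightarrow> x \<in> I \<Longrightarrow> dist (C0_fun (X n) x) (l x) < e / 2"
      using l unfolding uniform_limit_sequentially_iff by (meson half_gt_zero)
    have "norm (X n - L) \<le> e / 2" if "N \<le> n" for n
      by (rule norm_C0_leI)
        (use N[OF that] in \<open>auto simp: minus_C0.rep_eq L dist_real_def intro: less_imp_le\<close>)
    then show "\<exists>N. \<forall>n\<ge>N. dist (X n) L < e"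
      using \<open>0 < e\<close> by (intro exI[of _ N]) (fastforce simp: dist_norm)
  qed
  then show "convergent X" by (auto simp: convergent_def)
qed

text \<open>The \<open>C\<^sup>1\<close> topology does not see the Lipschitz constant of the derivative, but a
  bound on it is a closed condition, even for pointwise convergence of the derivatives. Therefore a
  \<open>C\<^sup>1\<close>-Cauchy sequence that is bounded in \<open>C\<^sup>1\<^sup>,\<^sup>1\<close> does not leave
  \<open>C\<^sup>1\<^sup>,\<^sup>1\<close> in the limit, and the fixed point argument can be run in the
  \<open>C\<^sup>1\<close> metric alone.\<close>

lemma complete_cball_C11_in_C1: "complete (C11_to_C1 ` cball 0 \<rho>)"
  unfolding complete_def
proof (intro allI impI, elim conjE)
  fix Y :: "nat \<Rightarrow> C1"
  assume Y: "\<forall>n. Y n \<in> C11_to_C1 ` cball 0 \<rho>" and "Cauchy Y"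
  from Y have "\<forall>n. \<exists>f. norm f \<le> \<rho> \<and> Y n = C11_to_C1 f"
    by (metis imageE mem_cball_0)
  then obtain X where X: "\<And>n. norm (X n) \<le> \<rho>" "\<And>n. Y n = C11_to_C1 (X n)"
    by metis
  have close: "\<bar>C11_fun (X m) x - C11_fun (X n) x\<bar> \<le> dist (Y m) (Y n)"
    "\<bar>D (C11_fun (X m)) x - D (C11_fun (X n)) x\<bar> \<le> dist (Y m) (Y n)" if "x \<in> I" for m n x
    using abs_C1_fun_le_norm[OF that, of "Y m - Y n"] that
    by (simp_all add: X dist_norm C11_to_C1.rep_eq minus_C1.rep_eq C11_D_ops)
  have "uniformly_Cauchy_on I (\<lambda>n. C11_fun (X n))" "uniformly_Cauchy_on I (\<lambda>n. D (C11_fun (X n)))"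
    unfolding uniformly_Cauchy_on_def dist_real_def
    using \<open>Cauchy Y\<close> close unfolding Cauchy_def by (meson order_le_less_trans)+
  then obtain g g' where lim: "uniform_limit I (\<lambda>n. C11_fun (X n)) g sequentially"
    and lim': "uniform_limit I (\<lambda>n. D (C11_fun (X n))) g' sequentially"
    using Cauchy_uniformly_convergent unfolding uniformly_convergent_on_def by meson
  define h where "h = (\<lambda>x. if x \<in> I then g x else 0)"
  have gx: "(\<lambda>n. C11_fun (X n) x) \<longlonglongrightarrow> g x" and g'x: "(\<lambda>n. D (C11_fun (X n)) x) \<longlonglongrightarrow> g' x"
    if "x \<in> I" for x
    using that tendsto_uniform_limitI[OF lim] tendsto_uniform_limitI[OF lim'] by auto
  have "\<exists>k. \<forall>x\<in>I. (\<lambda>n. C11_fun (X n) x) \<longlonglongrightarrow> k x \<and>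
      (k has_derivative (\<lambda>t. t * g' x)) (at x within I)"
  proof (rule has_derivative_sequence[of I _ "\<lambda>n x t. t * D (C11_fun (X n)) x"])
    show "(C11_fun (X n) has_derivative (\<lambda>t. t * D (C11_fun (X n)) x)) (at x within I)"
      if "x \<in> I" for n x
      using C11_has_field_derivative[OF that, of "X n"]
      by (simp add: has_field_derivative_def mult.commute[of _ "D (C11_fun (X n)) x"])
    show "\<forall>\<^sub>F n in sequentially. \<forall>x\<in>I. \<forall>t. norm (t * D (C11_fun (X n)) x - t * g' x) \<le> e * norm t"
      if "e > 0" for e
    proof -
      have "\<forall>\<^sub>F n in sequentially. \<forall>x\<in>I. dist (D (C11_fun (X n)) x) (g' x) < e"
        using lim' that unfolding uniform_limit_iff by blast
      then show ?thesis
      proof eventually_elim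
        case (elim n)
        have "\<bar>t\<bar> * \<bar>D (C11_fun (X n)) x - g' x\<bar> \<le> \<bar>t\<bar> * e" if "x \<in> I" for x t
          using elim that by (intro mult_left_mono) (auto simp: dist_real_def intro: less_imp_le)
        then show ?case
          by (simp add: abs_mult mult.commute flip: right_diff_distrib)
      qed
    qed
    show "(\<lambda>n. C11_fun (X n) 0) \<longlonglongrightarrow> g 0" by (rule gx) simp
  qed auto
  then obtain k where k: "\<And>x. x \<in> I \<Longrightarrow> (\<lambda>n. C11_fun (X n) x) \<longlonglongrightarrow> k x"
    "\<And>x. x \<in> I \<Longrightarrow> (k has_derivative (\<lambda>t. t * g' x)) (at x within I)"
    by blast
  have kg: "k x = h x" if "x \<in> I" for x
    using LIMSEQ_unique[OF k(1)[OF that] gx[OF that]] that by (simp add: h_def)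
  have der: "(h has_vector_derivative g' x) (at x within I)" if "x \<in> I" for x
    unfolding has_vector_derivative_def
    by (rule has_derivative_transform[OF that _ ])
      (use k(2)[OF that] kg in \<open>auto simp: that\<close>)
  have Dh: "D h x = g' x" if "x \<in> I" for x
    by (rule D_eq[OF der[OF that] that])
  have "0 \<le> \<rho>" using X(1)[of 0] norm_ge_zero order_trans by blast
  have lip: "\<bar>g' x - g' y\<bar> \<le> \<rho> * \<bar>x - y\<bar>" if "x \<in> I" "y \<in> I" for x y
  proof (rule LIMSEQ_le_const2)
    show "(\<lambda>n. \<bar>D (C11_fun (X n)) x - D (C11_fun (X n)) y\<bar>) \<longlonglongrightarrow> \<bar>g' x - g' y\<bar>"
      by (intro tendsto_intros g'x that)
    have "\<bar>D (C11_fun (X n)) x - D (C11_fun (X n)) y\<bar> \<le> \<rho> * \<bar>x - y\<bar>" for n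
      using D_C11_lipschitz[OF that, of "X n"] mult_right_mono[OF X(1)[of n], of "\<bar>x - y\<bar>"] by simp
    then show "\<exists>N. \<forall>n\<ge>N. \<bar>D (C11_fun (X n)) x - D (C11_fun (X n)) y\<bar> \<le> \<rho> * \<bar>x - y\<bar>" by blast
  qed
  have "\<rho>-lipschitz_on I (D h)"
    by (rule lipschitz_onI) (use lip \<open>0 \<le> \<rho>\<close> in \<open>auto simp: Dh dist_real_def\<close>)
  moreover have "\<forall>x\<in>I. h differentiable (at x within I)"
    using der differentiableI_vector by blast
  ultimately have "C11_fun (Abs_C11 h) = h"
    by (intro Abs_C11_inverse) (auto simp: h_def)
  moreover define H where "H = Abs_C11 h"
  ultimately have H: "C11_fun H = h" by simp
  have "norm H \<le> \<rho>"
  proof (rule norm_C11_leI)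
    fix x assume x: "x \<in> I"
    show "\<bar>C11_fun H x\<bar> \<le> \<rho>" unfolding H h_def using x
      by (simp, intro LIMSEQ_le_const2[OF tendsto_rabs[OF gx[OF x]]] exI[of _ 0])
        (use abs_C11_fun_le_norm(1)[OF x] X(1) order_trans in blast)
    show "\<bar>D (C11_fun H) x\<bar> \<le> \<rho>" unfolding H Dh[OF x]
      by (intro LIMSEQ_le_const2[OF tendsto_rabs[OF g'x[OF x]]] exI[of _ 0])
        (use abs_C11_fun_le_norm(2)[OF x] X(1) order_trans in blast)
  qed (simp add: H Dh lip)
  moreover have "Y \<longlonglongrightarrow> C11_to_C1 H"
    unfolding lim_sequentially
  proof (intro allI impI)
    fix e :: real assume "0 < e"
    then have "\<forall>\<^sub>F n in sequentially. \<forall>x\<in>I. dist (C11_fun (X n) x) (g x) < e / 2"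
      "\<forall>\<^sub>F n in sequentially. \<forall>x\<in>I. dist (D (C11_fun (X n)) x) (g' x) < e / 2"
      using lim lim' unfolding uniform_limit_iff by (meson half_gt_zero)+
    then have "\<forall>\<^sub>F n in sequentially. dist (Y n) (C11_to_C1 H) < e"
    proof eventually_elim
      case (elim n)
      have "norm (Y n - C11_to_C1 H) \<le> e / 2"
      proof (rule norm_C1_leI)
        fix x assume x: "x \<in> I"
        show "\<bar>C1_fun (Y n - C11_to_C1 H) x\<bar> \<le> e / 2"
          using elim(1) x
          by (auto simp: X minus_C1.rep_eq C11_to_C1.rep_eq H h_def dist_real_def intro: less_imp_le)
        have "D (C1_fun (Y n - C11_to_C1 H)) x = D (C11_fun (X n)) x - D (C11_fun H) x"
          using C11_D_ops(2)[OF x, of "X n" H] by (simp add: X minus_C1.rep_eq C11_to_C1.rep_eq)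
        then show "\<bar>D (C1_fun (Y n - C11_to_C1 H)) x\<bar> \<le> e / 2"
          using elim(2) x by (auto simp: H Dh dist_real_def intro: less_imp_le)
      qed
      then show ?case using \<open>0 < e\<close> by (simp add: dist_norm)
    qed
    then show "\<exists>N. \<forall>n\<ge>N. dist (Y n) (C11_to_C1 H) < e"
      by (simp add: eventually_sequentially)
  qed
  ultimately show "\<exists>l\<in>C11_to_C1 ` cball 0 \<rho>. Y \<longlonglongrightarrow> l" by auto
qed

section \<open>Self-composition on the ball of radius 1/2\<close>

lemma C11_fun_in_I: "norm f \<le> 1 \<Longrightarrow> x \<in> I \<Longrightarrow> C11_fun f x \<in> I"
  using abs_C11_fun_le_norm(1)[of x f] by (auto simp: abs_le_iff)

lemma comp_C11_apply:
  assumes "norm g \<le> 1" "x \<in> I"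
  shows "C11_fun (comp_C11 f g) x = C11_fun f (C11_fun g x)"
proof -
  have "C11_fun g ` I \<subseteq> I" using C11_fun_in_I[OF assms(1)] by blast
  then show ?thesis using assms(2) by (simp add: comp_C11.rep_eq)
qed

lemma D_comp_C11:
  assumes "norm g \<le> 1" "x \<in> I"
  shows "D (C11_fun (comp_C11 f g)) x = D (C11_fun f) (C11_fun g x) * D (C11_fun g) x"
proof (rule D_eq[OF _ assms(2)])
  have gI: "C11_fun g ` I \<subseteq> I" using C11_fun_in_I[OF assms(1)] by blast
  have "((\<lambda>x. C11_fun f (C11_fun g x)) has_vector_derivative
      D (C11_fun f) (C11_fun g x) * D (C11_fun g) x) (at x within I)"
    using C11_fun_in_I[OF assms] by (intro D_comp gI C11_props(1) assms)
  then show "(C11_fun (comp_C11 f g) has_vector_derivative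
      D (C11_fun f) (C11_fun g x) * D (C11_fun g) x) (at x within I)"
    by (rule has_vector_derivative_transform[OF assms(2), rotated])
      (simp add: comp_C11_apply assms(1))
qed

text \<open>The Lipschitz constant of \<open>(f' \<circ> f) * f'\<close> is at most \<open>s\<^sup>3 + s\<^sup>2\<close>
  with \<open>s = norm f\<close>; this is at most \<open>s\<close> as soon as \<open>s\<^sup>2 + s \<le> 1\<close>, and the bound
  \<open>1/2\<close> guarantees that. Bounding by \<open>norm f\<close>, not just by \<open>1/2\<close>, is what makes
  smaller closed balls invariant too.\<close>

lemma norm_comp_C11_self_le:
  assumes "norm f \<le> 1/2"
  shows "norm (comp_C11 f f) \<le> norm f"
proof (rule norm_C11_leI)
  let ?f = "C11_fun f" and ?f' = "D (C11_fun f)"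
  let ?s = "norm f"
  have f1: "norm f \<le> 1" using assms by simp
  have s: "0 \<le> ?s" by simp
  note val = abs_C11_fun_le_norm[of _ f]
  fix x assume x: "x \<in> I"
  then have fx: "?f x \<in> I" using C11_fun_in_I f1 by blast
  show "\<bar>C11_fun (comp_C11 f f) x\<bar> \<le> ?s"
    by (simp add: comp_C11_apply[OF f1 x] val(1)[OF fx])
  have "\<bar>?f' (?f x)\<bar> * \<bar>?f' x\<bar> \<le> ?s * 1"
    using val(2)[OF x] val(2)[OF fx] f1 by (intro mult_mono) auto
  then show "\<bar>D (C11_fun (comp_C11 f f)) x\<bar> \<le> ?s"
    by (simp add: D_comp_C11[OF f1 x] abs_mult)
  fix y assume y: "y \<in> I"
  then have fy: "?f y \<in> I" using C11_fun_in_I f1 by blast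
  have "\<bar>?f x - ?f y\<bar> \<le> ?s * \<bar>x - y\<bar>" by (rule C11_mean_value[OF val(2) x y])
  then have a: "\<bar>?f' (?f x) - ?f' (?f y)\<bar> \<le> ?s * (?s * \<bar>x - y\<bar>)"
    using D_C11_lipschitz[OF fx fy, of f] s by (meson mult_left_mono order_trans)
  have "?f' (?f x) * ?f' x - ?f' (?f y) * ?f' y
      = (?f' (?f x) - ?f' (?f y)) * ?f' x + ?f' (?f y) * (?f' x - ?f' y)"
    by (simp add: algebra_simps)
  also have "\<bar>\<dots>\<bar> \<le> \<bar>?f' (?f x) - ?f' (?f y)\<bar> * \<bar>?f' x\<bar> + \<bar>?f' (?f y)\<bar> * \<bar>?f' x - ?f' y\<bar>"
    by (metis abs_mult abs_triangle_ineq)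
  also have "\<dots> \<le> (?s * (?s * \<bar>x - y\<bar>)) * ?s + ?s * (?s * \<bar>x - y\<bar>)"
    using val(2)[OF x] val(2)[OF fy] D_C11_lipschitz[OF x y, of f] a
    by (intro add_mono mult_mono) auto
  also have "\<dots> = (?s * ?s + ?s) * (?s * \<bar>x - y\<bar>)" by (simp add: algebra_simps)
  also have "\<dots> \<le> 1 * (?s * \<bar>x - y\<bar>)"
  proof (rule mult_right_mono)
    have "?s * ?s \<le> 1/2 * (1/2)" by (intro mult_mono assms s) simp
    then show "?s * ?s + ?s \<le> 1" using assms by linarith
  qed simp
  finally show "\<bar>D (C11_fun (comp_C11 f f)) x - D (C11_fun (comp_C11 f f)) y\<bar> \<le> ?s * \<bar>x - y\<bar>"
    by (simp add: D_comp_C11[OF f1 x] D_comp_C11[OF f1 y])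
qed

text \<open>Split \<open>f \<circ> f - g \<circ> g\<close> as \<open>(f - g) \<circ> f + (g \<circ> f - g \<circ> g)\<close>: the
  first part is bounded by \<open>n\<close>, the second by \<open>n / 2\<close> because \<open>\<bar>g'\<bar> \<le> 1/2\<close>.\<close>

lemma comp_C11_self_pointwise_diff:
  assumes "norm f \<le> 1/2" "norm g \<le> 1/2" "x \<in> I"
    and n: "\<And>t. t \<in> I \<Longrightarrow> \<bar>C11_fun f t - C11_fun g t\<bar> \<le> n"
  shows "\<bar>C11_fun (comp_C11 f f) x - C11_fun (comp_C11 g g) x\<bar> \<le> 3/2 * n"
proof -
  have f1: "norm f \<le> 1" and g1: "norm g \<le> 1" using assms by auto
  have fx: "C11_fun f x \<in> I" and gx: "C11_fun g x \<in> I"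
    using C11_fun_in_I[OF f1 assms(3)] C11_fun_in_I[OF g1 assms(3)] by auto
  have "\<bar>D (C11_fun g) t\<bar> \<le> 1/2" if "t \<in> I" for t
    using abs_C11_fun_le_norm(2)[OF that, of g] assms(2) by simp
  from C11_mean_value[OF this fx gx]
  have "\<bar>C11_fun g (C11_fun f x) - C11_fun g (C11_fun g x)\<bar> \<le> 1/2 * n"
    using n[OF assms(3)] by simp
  with n[OF fx] have "\<bar>C11_fun f (C11_fun f x) - C11_fun g (C11_fun g x)\<bar> \<le> n + 1/2 * n"
    by arith
  then show ?thesis
    by (simp add: comp_C11_apply[OF f1 assms(3)] comp_C11_apply[OF g1 assms(3)])
qed

lemma C0_diff_comp_C11_self:
  assumes "norm f \<le> 1/2" "norm g \<le> 1/2"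
  shows "norm (C11_to_C0 (comp_C11 f f - comp_C11 g g)) \<le> 3/2 * norm (C11_to_C0 (f - g))"
proof (rule norm_C0_leI)
  fix x assume "x \<in> I"
  then show "\<bar>C0_fun (C11_to_C0 (comp_C11 f f - comp_C11 g g)) x\<bar> \<le> 3/2 * norm (C11_to_C0 (f - g))"
    unfolding C11_to_C0_fun minus_C11.rep_eq
    by (rule comp_C11_self_pointwise_diff[OF assms])
      (use abs_C0_fun_le_norm[of _ "C11_to_C0 (f - g)"] in \<open>simp add: C11_to_C0_fun minus_C11.rep_eq\<close>)
qed

text \<open>Comparing \<open>g' \<circ> f\<close> with \<open>g' \<circ> g\<close> would cost a modulus of continuity for a
  general \<open>C\<^sup>1\<close> map; with a Lipschitz derivative it costs only a multiple of \<open>f - g\<close>.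
  This is the reason for working in balls of \<open>C\<^sup>1\<^sup>,\<^sup>1\<close>. The derivatives then differ
  by at most \<open>1/2 + 1/4 + 1/2 \<le> 3/2\<close> times the distance.\<close>

lemma C1_diff_comp_C11_self:
  assumes f: "norm f \<le> 1/2" and g: "norm g \<le> 1/2"
  shows "norm (C11_to_C1 (comp_C11 f f - comp_C11 g g)) \<le> 3/2 * norm (C11_to_C1 (f - g))"
    (is "_ \<le> _ * ?n")
proof (rule norm_C1_leI)
  have n: "\<bar>C11_fun f t - C11_fun g t\<bar> \<le> ?n"
    "\<bar>D (C11_fun f) t - D (C11_fun g) t\<bar> \<le> ?n" if "t \<in> I" for t
    using abs_C1_fun_le_norm[OF that, of "C11_to_C1 (f - g)"]
    by (simp_all add: C11_to_C1.rep_eq minus_C11.rep_eq C11_D_ops[OF that])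
  fix x assume x: "x \<in> I"
  show "\<bar>C1_fun (C11_to_C1 (comp_C11 f f - comp_C11 g g)) x\<bar> \<le> 3/2 * ?n"
    unfolding C11_to_C1.rep_eq minus_C11.rep_eq
    by (rule comp_C11_self_pointwise_diff[OF assms x n(1)])
  have f1: "norm f \<le> 1" and g1: "norm g \<le> 1" using assms by auto
  let ?f = "C11_fun f" and ?f' = "D (C11_fun f)" and ?g = "C11_fun g" and ?g' = "D (C11_fun g)"
  have fx: "?f x \<in> I" and gx: "?g x \<in> I"
    using C11_fun_in_I[OF f1 x] C11_fun_in_I[OF g1 x] by auto
  have f': "\<bar>?f' t\<bar> \<le> 1/2" and g': "\<bar>?g' t\<bar> \<le> 1/2" if "t \<in> I" for t
    using abs_C11_fun_le_norm(2)[OF that, of f] abs_C11_fun_le_norm(2)[OF that, of g] f g by auto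
  have a: "\<bar>?g' (?f x) - ?g' (?g x)\<bar> \<le> 1/2 * ?n"
    using D_C11_lipschitz[OF fx gx, of g] mult_mono[OF g n(1)[OF x]] by simp
  have split: "?f' (?f x) * ?f' x - ?g' (?g x) * ?g' x = (?f' (?f x) - ?g' (?f x)) * ?f' x
      + (?g' (?f x) - ?g' (?g x)) * ?f' x + ?g' (?g x) * (?f' x - ?g' x)"
    by (simp add: algebra_simps)
  have "\<bar>?f' (?f x) * ?f' x - ?g' (?g x) * ?g' x\<bar> \<le> \<bar>?f' (?f x) - ?g' (?f x)\<bar> * \<bar>?f' x\<bar>
      + \<bar>?g' (?f x) - ?g' (?g x)\<bar> * \<bar>?f' x\<bar> + \<bar>?g' (?g x)\<bar> * \<bar>?f' x - ?g' x\<bar>"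
    unfolding split abs_mult[symmetric] by linarith
  also have "\<dots> \<le> ?n * (1/2) + (1/2 * ?n) * (1/2) + 1/2 * ?n"
    using n(2)[OF fx] f'[OF x] a g'[OF gx] n(2)[OF x] by (intro add_mono mult_mono) auto
  also have "\<dots> \<le> 3/2 * ?n" by simp
  finally show "\<bar>D (C1_fun (C11_to_C1 (comp_C11 f f - comp_C11 g g))) x\<bar> \<le> 3/2 * ?n"
    by (simp add: C11_to_C1.rep_eq minus_C11.rep_eq C11_D_ops[OF x] D_comp_C11[OF f1 x] D_comp_C11[OF g1 x])
qed

section \<open>The fixed point and its Lipschitz dependence on the parameter\<close>

lemma norm_F_le:
  assumes "norm f \<le> 1/2"
  shows "norm (F u f) \<le> 1/2 * norm f + norm u"
proof -
  have "norm (F u f) \<le> norm ((1/2) *\<^sub>R comp_C11 f f) + norm u"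
    unfolding F_def by (rule norm_triangle_ineq)
  then show ?thesis using norm_comp_C11_self_le[OF assms] by simp
qed

lemma F_diff: "F u f - F v g = (1/2) *\<^sub>R (comp_C11 f f - comp_C11 g g) + (u - v)"
  by (simp add: F_def algebra_simps)

lemma C1_dist_F_le:
  assumes "norm f \<le> 1/2" "norm g \<le> 1/2"
  shows "norm (C11_to_C1 (F u f - F v g)) \<le> 3/4 * norm (C11_to_C1 (f - g)) + norm (u - v)"
proof -
  interpret bounded_linear C11_to_C1 by (rule bounded_linear_C11_to_C1)
  have "norm (C11_to_C1 (F u f - F v g))
      \<le> 1/2 * norm (C11_to_C1 (comp_C11 f f - comp_C11 g g)) + norm (C11_to_C1 (u - v))"
    unfolding F_diff add scaleR using norm_triangle_ineq[of "(1/2) *\<^sub>R _"] by force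
  then show ?thesis
    using C1_diff_comp_C11_self[OF assms] norm_C11_to_C1_le[of "u - v"] by linarith
qed

lemma C0_dist_F_le:
  assumes "norm f \<le> 1/2" "norm g \<le> 1/2"
  shows "norm (C11_to_C0 (F u f - F v g)) \<le> 3/4 * norm (C11_to_C0 (f - g)) + norm (u - v)"
proof -
  interpret bounded_linear C11_to_C0 by (rule bounded_linear_C11_to_C0)
  have "norm (C11_to_C0 (F u f - F v g))
      \<le> 1/2 * norm (C11_to_C0 (comp_C11 f f - comp_C11 g g)) + norm (C11_to_C0 (u - v))"
    unfolding F_diff add scaleR using norm_triangle_ineq[of "(1/2) *\<^sub>R _"] by force
  then show ?thesis
    using C0_diff_comp_C11_self[OF assms] norm_C11_to_C0_le[of "u - v"] by linarith
qed

text \<open>The ball of the contraction is open, hence not complete. The iteration takes place in the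
  closed ball of radius \<open>2 * norm u < 1/2\<close>, which is invariant since
  \<open>1/2 * (2 * norm u) + norm u = 2 * norm u\<close>.\<close>

lemma fixed_point_exists:
  assumes "norm u < 1/4"
  shows "\<exists>f. norm f < 1/2 \<and> F u f = f"
proof -
  define \<rho> where "\<rho> = 2 * norm u"
  have \<rho>: "0 \<le> \<rho>" "\<rho> < 1/2" using assms by (auto simp: \<rho>_def)
  let ?inv = "inv C11_to_C1"
  have inv: "?inv (C11_to_C1 f) = f" for f by (rule inv_f_f[OF inj_C11_to_C1])
  have "\<exists>!w. w \<in> C11_to_C1 ` cball 0 \<rho> \<and> C11_to_C1 (F u (?inv w)) = w"
  proof (rule Banach_fix[of _ "3/4"])
    show "complete (C11_to_C1 ` cball 0 \<rho>)" by (rule complete_cball_C11_in_C1)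
    show "C11_to_C1 ` cball 0 \<rho> \<noteq> {}" using \<rho> by simp
    have "norm (F u f) \<le> \<rho>" if "norm f \<le> \<rho>" for f
      using norm_F_le[of f u] that \<rho> by (simp add: \<rho>_def)
    then show "(\<lambda>w. C11_to_C1 (F u (?inv w))) ` C11_to_C1 ` cball 0 \<rho> \<subseteq> C11_to_C1 ` cball 0 \<rho>"
      by (auto simp: inv)
    have "norm (C11_to_C1 (F u f - F u g)) \<le> 3/4 * norm (C11_to_C1 (f - g))"
      if "norm f \<le> \<rho>" "norm g \<le> \<rho>" for f g
      using C1_dist_F_le[of f g u u] that \<rho> by simp
    then show "dist (C11_to_C1 (F u (?inv v))) (C11_to_C1 (F u (?inv w))) \<le> 3/4 * dist v w"
      if "v \<in> C11_to_C1 ` cball 0 \<rho>" "w \<in> C11_to_C1 ` cball 0 \<rho>" for v w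
      using that by (auto simp: inv dist_norm C11_to_C1_diff)
  qed auto
  then obtain w where "w \<in> C11_to_C1 ` cball 0 \<rho>" "C11_to_C1 (F u (?inv w)) = w" by blast
  then obtain f where "norm f \<le> \<rho>" "C11_to_C1 (F u f) = C11_to_C1 f"
    by (auto simp: inv)
  then show ?thesis using \<rho> injD[OF inj_C11_to_C1] by force
qed

text \<open>If \<open>d\<close> is the distance of the fixed points, then
  \<open>d \<le> 3/4 * d + norm (u - v)\<close>.\<close>

lemma fixed_points_lipschitz:
  assumes "norm f < 1/2" "F u f = f" "norm g < 1/2" "F v g = g"
  shows "norm (C11_to_C1 f - C11_to_C1 g) \<le> 4 * norm (u - v)"
    and "norm (C11_to_C0 f - C11_to_C0 g) \<le> 4 * norm (u - v)"
  using C1_dist_F_le[of f g u v] C0_dist_F_le[of f g u v] assms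
  by (simp_all add: C11_to_C1_diff C11_to_C0_diff)

section \<open>The linearisation\<close>

text \<open>The formal derivative of \<open>f \<mapsto> 1/2 * (f \<circ> f)\<close> in the direction \<open>w\<close>. It does not
  involve \<open>w'\<close>, so it makes sense on all of \<open>C\<^sup>0\<close>, the space on which \<open>1 - Q\<close> has
  to be inverted. When \<open>f\<close> does not map \<open>I\<close> into itself the value is 0, as for
  \<open>comp_C11\<close>.\<close>

lift_definition lin_comp :: "C11 \<Rightarrow> C0 \<Rightarrow> C0" is
  "\<lambda>f w x. if f ` I \<subseteq> I \<and> x \<in> I then (D f (f x) * w x + w (f x)) / 2 else 0"
proof -
  fix f w :: "real \<Rightarrow> real"
  let ?h = "\<lambda>x. if f ` I \<subseteq> I \<and> x \<in> I then (D f (f x) * w x + w (f x)) / 2 else 0"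
  assume f: "(\<forall>x\<in>I. f differentiable (at x within I)) \<and> (\<exists>L. L-lipschitz_on I (D f)) \<and>
    (\<forall>x. x \<notin> I \<longrightarrow> f x = 0)" and w: "continuous_on I w \<and> (\<forall>x. x \<notin> I \<longrightarrow> w x = 0)"
  have "continuous_on I ?h"
  proof (cases "f ` I \<subseteq> I")
    case True
    have cf: "continuous_on I f" and cD: "continuous_on I (D f)"
      using f continuous_on_differentiable_I lipschitz_on_continuous_on by blast+
    have "continuous_on I (\<lambda>x. (D f (f x) * w x + w (f x)) / 2)"
      by (intro continuous_intros continuous_on_compose2[OF cD cf]
          continuous_on_compose2[OF _ cf, of I w] True) (use w in auto)
    then show ?thesis by (rule continuous_on_eq) (use True in auto)
  next
    case False
    then have zero: "?h = (\<lambda>x. 0)" by auto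
    show ?thesis unfolding zero by (rule continuous_on_const)
  qed
  then show "continuous_on I ?h \<and> (\<forall>x. x \<notin> I \<longrightarrow> ?h x = 0)" by auto
qed

lemma lin_comp_apply:
  assumes "norm f \<le> 1" "x \<in> I"
  shows "C0_fun (lin_comp f w) x =
    (D (C11_fun f) (C11_fun f x) * C0_fun w x + C0_fun w (C11_fun f x)) / 2"
proof -
  have "C11_fun f ` I \<subseteq> I" using C11_fun_in_I[OF assms(1)] by blast
  then show ?thesis using assms(2) by (simp add: lin_comp.rep_eq)
qed

lemma linear_lin_comp: "linear (lin_comp f)"
proof (rule linearI)
  show "lin_comp f (v + w) = lin_comp f v + lin_comp f w" for v w
    by transfer (auto simp: fun_eq_iff algebra_simps add_divide_distrib)
  show "lin_comp f (c *\<^sub>R w) = c *\<^sub>R lin_comp f w" for c w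
    by transfer (auto simp: fun_eq_iff algebra_simps)
qed

lemma norm_lin_comp_le:
  assumes "norm f \<le> 1/2"
  shows "norm (lin_comp f w) \<le> 3/4 * norm w"
proof (rule norm_C0_leI)
  fix x assume x: "x \<in> I"
  have f1: "norm f \<le> 1" using assms by simp
  have fx: "C11_fun f x \<in> I" by (rule C11_fun_in_I[OF f1 x])
  have "\<bar>D (C11_fun f) (C11_fun f x)\<bar> \<le> 1/2"
    using abs_C11_fun_le_norm(2)[OF fx, of f] assms by simp
  then have prod: "\<bar>D (C11_fun f) (C11_fun f x) * C0_fun w x\<bar> \<le> 1/2 * norm w"
    unfolding abs_mult using abs_C0_fun_le_norm[OF x, of w] by (intro mult_mono) auto
  have "\<bar>D (C11_fun f) (C11_fun f x) * C0_fun w x + C0_fun w (C11_fun f x)\<bar>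
      \<le> 1/2 * norm w + norm w"
    using prod abs_C0_fun_le_norm[OF fx, of w] by (intro order_trans[OF abs_triangle_ineq] add_mono)
  then show "\<bar>C0_fun (lin_comp f w) x\<bar> \<le> 3/4 * norm w"
    by (simp add: lin_comp_apply[OF f1 x])
qed

text \<open>The increment \<open>z\<close> enters \<open>(f + z) \<circ> (f + z)\<close> twice. As an argument of \<open>f\<close> it
  is handled by Taylor's formula, as an argument of itself by the mean value theorem; only the latter
  needs the derivative of \<open>z\<close>.\<close>

lemma F_expansion:
  assumes f: "norm f \<le> 1/2" and fz: "norm (f + z) \<le> 1/2"
  shows "norm (C11_to_C0 (F (u + h) (f + z)) - C11_to_C0 (F u f)
      - (C11_to_C0 h + lin_comp f (C11_to_C0 z))) \<le> norm (C11_to_C0 z) * norm (C11_to_C1 z)"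
    (is "norm ?R \<le> ?m * ?n")
proof (rule norm_C0_leI)
  fix x assume x: "x \<in> I"
  let ?f = "C11_fun f" and ?z = "C11_fun z"
  have f1: "norm f \<le> 1" and fz1: "norm (f + z) \<le> 1" using assms by auto
  have fx: "?f x \<in> I" and fzx: "?f x + ?z x \<in> I"
    using C11_fun_in_I[OF f1 x] C11_fun_in_I[OF fz1 x] by (auto simp: plus_C11.rep_eq)
  have zx: "\<bar>?z x\<bar> \<le> ?m"
    using abs_C0_fun_le_norm[OF x, of "C11_to_C0 z"] by (simp add: C11_to_C0_fun)
  have z1: "\<bar>?z t\<bar> \<le> ?n" "\<bar>D ?z t\<bar> \<le> ?n" if "t \<in> I" for t
    using abs_C1_fun_le_norm[OF that, of "C11_to_C1 z"] by (simp_all add: C11_to_C1.rep_eq)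
  have "\<bar>?f (?f x + ?z x) - ?f (?f x) - D ?f (?f x) * ?z x\<bar> \<le> norm f * \<bar>?z x\<bar>\<^sup>2"
    using C11_taylor[OF fx fzx, of f] by simp
  also have "\<dots> \<le> 1/2 * (?m * ?n)"
    unfolding power2_eq_square using f zx z1(1)[OF x] by (intro mult_mono) auto
  finally have a: "\<bar>?f (?f x + ?z x) - ?f (?f x) - D ?f (?f x) * ?z x\<bar> \<le> 1/2 * (?m * ?n)" .
  have "\<bar>?z (?f x + ?z x) - ?z (?f x)\<bar> \<le> ?n * \<bar>?z x\<bar>"
    using C11_mean_value[OF z1(2) fzx fx] by simp
  also have "\<dots> \<le> ?m * ?n"
    using zx by (subst mult.commute) (intro mult_right_mono, auto)
  finally have b: "\<bar>?z (?f x + ?z x) - ?z (?f x)\<bar> \<le> ?m * ?n" .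
  have "C0_fun ?R x = ((?f (?f x + ?z x) - ?f (?f x) - D ?f (?f x) * ?z x)
      + (?z (?f x + ?z x) - ?z (?f x))) / 2"
    using x by (simp add: minus_C0.rep_eq plus_C0.rep_eq C11_to_C0_fun F_def plus_C11.rep_eq
        scaleR_C11.rep_eq comp_C11_apply[OF f1 x] comp_C11_apply[OF fz1 x] lin_comp_apply[OF f1 x]
        field_simps)
  then show "\<bar>C0_fun ?R x\<bar> \<le> ?m * ?n" using a b by (simp, linarith)
qed

text \<open>The operator \<open>S\<close> is the inverse of \<open>1 - Q\<close>. Solving \<open>w = y + Q w\<close> by
  contraction replaces the Neumann series, and uniqueness of the solution yields linearity.\<close>

lemma linear_fixed_point_operator:
  fixes Q :: "'a :: banach \<Rightarrow> 'a"
  assumes Q: "linear Q" and le: "\<And>w. norm (Q w) \<le> k * norm w" and k: "0 \<le> k" "k < 1"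
  obtains S where "bounded_linear S" "\<And>y. S y = y + Q (S y)"
proof -
  have uniq: "v = w" if "v = y + Q v" "w = y + Q w" for v w y
  proof -
    have "v - w = Q (v - w)" using that linear_diff[OF Q] by (metis add_diff_cancel_left)
    then have "norm (v - w) \<le> k * norm (v - w)" using le by metis
    then show ?thesis using k
      by (smt (verit) mult_less_cancel_right2 norm_eq_zero norm_ge_zero right_minus_eq)
  qed
  have "\<exists>w. w = y + Q w" for y
  proof -
    have "\<exists>!w. w \<in> UNIV \<and> y + Q w = w"
      by (rule Banach_fix[of _ k])
        (auto simp: k dist_norm complete_UNIV le simp flip: linear_diff[OF Q])
    then show ?thesis by metis
  qed
  then obtain S where S: "\<And>y. S y = y + Q (S y)" by metis
  have "bounded_linear S"
  proof (rule bounded_linear_intro)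
    show "S (x + y) = S x + S y" for x y
    proof (rule uniq)
      show "S x + S y = x + y + Q (S x + S y)"
        unfolding linear_add[OF Q] using S[of x] S[of y] by (metis add.assoc add.left_commute)
    qed (rule S)
    show "S (c *\<^sub>R x) = c *\<^sub>R S x" for c x
    proof (rule uniq)
      show "c *\<^sub>R S x = c *\<^sub>R x + Q (c *\<^sub>R S x)"
        unfolding linear_scale[OF Q] using S[of x] by (metis scaleR_right_distrib)
    qed (rule S)
    show "norm (S x) \<le> norm x * (1 / (1 - k))" for x
    proof -
      have "norm (S x) \<le> norm x + k * norm (S x)"
        using S[of x] norm_triangle_ineq[of x "Q (S x)"] le[of "S x"] by simp
      then show ?thesis using k by (simp add: field_simps)
    qed
  qed
  then show ?thesis using S that by blast
qed

text \<open>The remainder in \<open>F_expansion\<close> is the product of two norms of the increment, each at most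
  \<open>4 * norm (v - u)\<close>. Inverting \<open>1 - Q\<close> costs another factor 4, whence the constant
  \<open>64 = 4 * 4 * 4\<close>.\<close>

lemma fixed_point_differentiable:
  assumes \<phi>: "\<And>u. u \<in> U \<Longrightarrow> norm (\<phi> u) < 1/2 \<and> F u (\<phi> u) = \<phi> u" and u: "u \<in> U"
  shows "(\<lambda>u. C11_to_C0 (\<phi> u)) differentiable (at u within U)"
proof -
  let ?Q = "lin_comp (\<phi> u)"
  have \<phi>u: "norm (\<phi> u) \<le> 1/2" using \<phi>[OF u] by simp
  obtain S where S: "bounded_linear S" "\<And>y. S y = y + ?Q (S y)"
    by (rule linear_fixed_point_operator[OF linear_lin_comp norm_lin_comp_le[OF \<phi>u]]) auto
  have "((\<lambda>u. C11_to_C0 (\<phi> u)) has_derivative (\<lambda>h. S (C11_to_C0 h))) (at u within U)"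
  proof (rule has_derivativeI_sandwich[of 1 _ _ _ _ "\<lambda>v. 64 * norm (v - u)"])
    show "bounded_linear (\<lambda>h. S (C11_to_C0 h))"
      by (rule bounded_linear_compose[OF S(1) bounded_linear_C11_to_C0])
    have "((\<lambda>v. 64 * norm (v - u)) \<longlongrightarrow> 64 * norm (u - u)) (at u within U)"
      by (intro tendsto_intros)
    then show "((\<lambda>v. 64 * norm (v - u)) \<longlongrightarrow> 0) (at u within U)" by simp
    fix v assume v: "v \<in> U" "v \<noteq> u"
    define z where "z = \<phi> v - \<phi> u"
    let ?E = "C11_to_C0 z - S (C11_to_C0 (v - u))"
    let ?R = "C11_to_C0 z - (C11_to_C0 (v - u) + ?Q (C11_to_C0 z))"
    have "norm ?R \<le> norm (C11_to_C0 z) * norm (C11_to_C1 z)"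
      using F_expansion[of "\<phi> u" z u "v - u"] \<phi>[OF u] \<phi>[OF v(1)]
      by (simp add: z_def C11_to_C0_diff)
    also have "\<dots> \<le> (4 * norm (v - u)) * (4 * norm (v - u))"
      using fixed_points_lipschitz[of "\<phi> v" v "\<phi> u" u] \<phi>[OF u] \<phi>[OF v(1)]
      by (intro mult_mono) (auto simp: z_def C11_to_C0_diff C11_to_C1_diff)
    finally have R: "norm ?R \<le> 16 * norm (v - u) * norm (v - u)" by simp
    (* ?E solves the linear equation with right-hand side ?R, so the contraction bound on ?Q controls it. *)
    have "?E = ?R + ?Q ?E"
      unfolding linear_diff[OF linear_lin_comp] using S(2)[of "C11_to_C0 (v - u)"]
      by (simp add: algebra_simps)
    then have "norm ?E \<le> norm ?R + norm (?Q ?E)" by (metis norm_triangle_ineq)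
    then have "norm ?E \<le> norm ?R + 3/4 * norm ?E"
      using norm_lin_comp_le[OF \<phi>u, of ?E] by linarith
    with R have "norm ?E \<le> 64 * norm (v - u) * norm (v - u)" by simp
    then show "norm (C11_to_C0 (\<phi> v) - C11_to_C0 (\<phi> u) - S (C11_to_C0 (v - u))) / norm (v - u)
        \<le> 64 * norm (v - u)"
      using v(2) by (simp add: z_def C11_to_C0_diff divide_le_eq)
  qed simp
  then show ?thesis unfolding differentiable_def by blast
qed

theorem theorem5:
  shows "\<exists>r r' :: real. 0 < r \<and> r < 1 \<and> 0 < r' \<and> r' < 1 \<and>
    (\<exists>k<1. \<forall>u\<in>ball 0 r'.
        (\<forall>\<phi>\<in>ball 0 r. F u \<phi> \<in> ball 0 r) \<and>
        (\<forall>\<phi>\<in>ball 0 r. \<forall>\<psi>\<in>ball 0 r.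
          norm (C11_to_C1 (F u \<phi>) - C11_to_C1 (F u \<psi>)) \<le> k * norm (C11_to_C1 \<phi> - C11_to_C1 \<psi>))) \<and>
    (\<exists>\<phi> :: C11 \<Rightarrow> C11.
        (\<forall>u\<in>ball 0 r'. \<phi> u \<in> ball 0 r \<and> F u (\<phi> u) = \<phi> u) \<and>
        continuous_on (ball 0 r') (\<lambda>u. C11_to_C1 (\<phi> u)) \<and>
        (\<forall>u\<^sub>0\<in>ball 0 r'. \<exists>(P :: C11 \<Rightarrow> C0) (Q :: C1 \<Rightarrow> C0) (\<epsilon> :: C11 \<Rightarrow> C11 \<Rightarrow> C0).
            bounded_linear P \<and>
            linear Q \<and> (\<exists>K. \<forall>w. norm (Q w) \<le> K * norm (C1_to_C0 w)) \<and>
            (\<forall>h z. u\<^sub>0 + h \<in> ball 0 r' \<and> \<phi> u\<^sub>0 + z \<in> ball 0 r \<longrightarrow>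
              C11_to_C0 (F (u\<^sub>0 + h) (\<phi> u\<^sub>0 + z)) - C11_to_C0 (F u\<^sub>0 (\<phi> u\<^sub>0)) =
                P h + Q (C11_to_C1 z) + (norm h + norm (C11_to_C0 z)) *\<^sub>R \<epsilon> h z) \<and>
            (\<forall>e>0. \<exists>d>0. \<forall>h z. u\<^sub>0 + h \<in> ball 0 r' \<and> \<phi> u\<^sub>0 + z \<in> ball 0 r \<and>
              norm h < d \<and> norm (C11_to_C1 z) < d \<longrightarrow> norm (\<epsilon> h z) < e)) \<and>
        (\<lambda>u. C11_to_C0 (\<phi> u)) differentiable_on ball 0 r')"
proof (rule exI[of _ "1/2"], rule exI[of _ "1/4"], intro conjI)
  have "F u f \<in> ball 0 (1/2)" if "u \<in> ball 0 (1/4)" "f \<in> ball 0 (1/2)" for u f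
    using norm_F_le[of f u] that by simp
  moreover have "norm (C11_to_C1 (F u f) - C11_to_C1 (F u g))
      \<le> 3/4 * norm (C11_to_C1 f - C11_to_C1 g)"
    if "f \<in> ball 0 (1/2)" "g \<in> ball 0 (1/2)" for u f g
    using C1_dist_F_le[of f g u u] that by (simp add: C11_to_C1_diff)
  ultimately show "\<exists>k<1. \<forall>u\<in>ball 0 (1/4).
      (\<forall>f\<in>ball 0 (1/2). F u f \<in> ball 0 (1/2)) \<and>
      (\<forall>f\<in>ball 0 (1/2). \<forall>g\<in>ball 0 (1/2).
        norm (C11_to_C1 (F u f) - C11_to_C1 (F u g)) \<le> k * norm (C11_to_C1 f - C11_to_C1 g))"
    by (intro exI[of _ "3/4"]) auto
next
  have "\<forall>u\<in>ball 0 (1/4). \<exists>f. norm f < 1/2 \<and> F u f = f"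
    using fixed_point_exists by simp
  then obtain \<phi> where \<phi>: "\<And>u. u \<in> ball 0 (1/4) \<Longrightarrow> norm (\<phi> u) < 1/2 \<and> F u (\<phi> u) = \<phi> u"
    by metis
  have cont: "continuous_on (ball 0 (1/4)) (\<lambda>u. C11_to_C1 (\<phi> u))"
    by (rule lipschitz_on_continuous_on[of 4], rule lipschitz_onI)
      (use fixed_points_lipschitz(1) \<phi> in \<open>auto simp: dist_norm\<close>)
  have expansion: "\<exists>(P :: C11 \<Rightarrow> C0) (Q :: C1 \<Rightarrow> C0) (\<epsilon> :: C11 \<Rightarrow> C11 \<Rightarrow> C0).
      bounded_linear P \<and> linear Q \<and> (\<exists>K. \<forall>w. norm (Q w) \<le> K * norm (C1_to_C0 w)) \<and>
      (\<forall>h z. u\<^sub>0 + h \<in> ball 0 (1/4) \<and> \<phi> u\<^sub>0 + z \<in> ball 0 (1/2) \<longrightarrow>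
        C11_to_C0 (F (u\<^sub>0 + h) (\<phi> u\<^sub>0 + z)) - C11_to_C0 (F u\<^sub>0 (\<phi> u\<^sub>0)) =
          P h + Q (C11_to_C1 z) + (norm h + norm (C11_to_C0 z)) *\<^sub>R \<epsilon> h z) \<and>
      (\<forall>e>0. \<exists>d>0. \<forall>h z. u\<^sub>0 + h \<in> ball 0 (1/4) \<and> \<phi> u\<^sub>0 + z \<in> ball 0 (1/2) \<and>
        norm h < d \<and> norm (C11_to_C1 z) < d \<longrightarrow> norm (\<epsilon> h z) < e)"
    if u: "u\<^sub>0 \<in> ball 0 (1/4)" for u\<^sub>0
  proof -
    have \<phi>u: "norm (\<phi> u\<^sub>0) \<le> 1/2" using \<phi>[OF u] by simp
    define Q where "Q = (\<lambda>w. lin_comp (\<phi> u\<^sub>0) (C1_to_C0 w))"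
    define R where "R = (\<lambda>h z. C11_to_C0 (F (u\<^sub>0 + h) (\<phi> u\<^sub>0 + z)) - C11_to_C0 (F u\<^sub>0 (\<phi> u\<^sub>0))
      - (C11_to_C0 h + Q (C11_to_C1 z)))"
    (* If both norms vanish, then R h z = 0 by the bound below, and the value inverse 0 = 0 does no harm. *)
    define \<epsilon> where "\<epsilon> = (\<lambda>h z. inverse (norm h + norm (C11_to_C0 z)) *\<^sub>R R h z)"
    have R: "norm (R h z) \<le> norm (C11_to_C0 z) * norm (C11_to_C1 z)"
      if "\<phi> u\<^sub>0 + z \<in> ball 0 (1/2)" for h z
      using F_expansion[OF \<phi>u, of z u\<^sub>0 h] that by (simp add: R_def Q_def C11_to_C0_def)
    have "linear Q"
      unfolding Q_def
      by (rule linear_compose[OF bounded_linear.linear[OF bounded_linear_C1_to_C0] linear_lin_comp,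
            unfolded o_def])
    moreover have "\<forall>w. norm (Q w) \<le> 3/4 * norm (C1_to_C0 w)"
      unfolding Q_def by (intro allI norm_lin_comp_le \<phi>u)
    moreover have "C11_to_C0 (F (u\<^sub>0 + h) (\<phi> u\<^sub>0 + z)) - C11_to_C0 (F u\<^sub>0 (\<phi> u\<^sub>0)) =
        C11_to_C0 h + Q (C11_to_C1 z) + (norm h + norm (C11_to_C0 z)) *\<^sub>R \<epsilon> h z"
      if "\<phi> u\<^sub>0 + z \<in> ball 0 (1/2)" for h z
    proof -
      have "(norm h + norm (C11_to_C0 z)) *\<^sub>R \<epsilon> h z = R h z"
      proof (cases "norm h + norm (C11_to_C0 z) = 0")
        case True
        then have "norm (C11_to_C0 z) = 0"
          by (smt (verit) norm_ge_zero)
        then have "R h z = 0" using R[OF that, of h] by simp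
        then show ?thesis by (simp add: \<epsilon>_def)
      qed (simp add: \<epsilon>_def)
      then show ?thesis by (simp add: R_def)
    qed
    moreover have small: "norm (\<epsilon> h z) \<le> norm (C11_to_C1 z)"
      if "\<phi> u\<^sub>0 + z \<in> ball 0 (1/2)" for h z
    proof (cases "norm h + norm (C11_to_C0 z) = 0")
      case False
      then have pos: "0 < norm h + norm (C11_to_C0 z)"
        by (smt (verit) norm_ge_zero)
      have "norm (R h z) \<le> (norm h + norm (C11_to_C0 z)) * norm (C11_to_C1 z)"
        using R[OF that, of h] by (rule order_trans) (intro mult_right_mono, auto)
      then show ?thesis using pos by (simp add: \<epsilon>_def field_simps)
    qed (simp add: \<epsilon>_def)
    moreover have "\<exists>d>0. \<forall>h z. u\<^sub>0 + h \<in> ball 0 (1/4) \<and> \<phi> u\<^sub>0 + z \<in> ball 0 (1/2) \<and>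
        norm h < d \<and> norm (C11_to_C1 z) < d \<longrightarrow> norm (\<epsilon> h z) < e" if "e > 0" for e
      using that small by (intro exI[of _ e]) (auto intro: le_less_trans)
    ultimately show ?thesis
      using bounded_linear_C11_to_C0
      by (intro exI[of _ C11_to_C0] exI[of _ Q] exI[of _ \<epsilon>]) blast
  qed
  have "(\<lambda>u. C11_to_C0 (\<phi> u)) differentiable_on ball 0 (1/4)"
    unfolding differentiable_on_def using fixed_point_differentiable \<phi> by blast
  then show "\<exists>\<phi> :: C11 \<Rightarrow> C11.
      (\<forall>u\<in>ball 0 (1/4). \<phi> u \<in> ball 0 (1/2) \<and> F u (\<phi> u) = \<phi> u) \<and>
      continuous_on (ball 0 (1/4)) (\<lambda>u. C11_to_C1 (\<phi> u)) \<and>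
      (\<forall>u\<^sub>0\<in>ball 0 (1/4). \<exists>(P :: C11 \<Rightarrow> C0) (Q :: C1 \<Rightarrow> C0) (\<epsilon> :: C11 \<Rightarrow> C11 \<Rightarrow> C0).
        bounded_linear P \<and> linear Q \<and> (\<exists>K. \<forall>w. norm (Q w) \<le> K * norm (C1_to_C0 w)) \<and>
        (\<forall>h z. u\<^sub>0 + h \<in> ball 0 (1/4) \<and> \<phi> u\<^sub>0 + z \<in> ball 0 (1/2) \<longrightarrow>
          C11_to_C0 (F (u\<^sub>0 + h) (\<phi> u\<^sub>0 + z)) - C11_to_C0 (F u\<^sub>0 (\<phi> u\<^sub>0)) =
            P h + Q (C11_to_C1 z) + (norm h + norm (C11_to_C0 z)) *\<^sub>R \<epsilon> h z) \<and>
        (\<forall>e>0. \<exists>d>0. \<forall>h z. u\<^sub>0 + h \<in> ball 0 (1/4) \<and> \<phi> u\<^sub>0 + z \<in> ball 0 (1/2) \<and>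
          norm h < d \<and> norm (C11_to_C1 z) < d \<longrightarrow> norm (\<epsilon> h z) < e)) \<and>
      (\<lambda>u. C11_to_C0 (\<phi> u)) differentiable_on ball 0 (1/4)"
    using cont expansion \<phi> by (intro exI[of _ \<phi>] conjI ballI) simp_all
qed simp_all

end
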